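(* Assume there exist complex scalars $a,b,c,a^*,b^*,c^*,x$ such that one of the following eight cases holds (with the formulas for $\xi_i$ valid for $0\le i\le N-1$ and those for $\theta_i,\theta^*_i$ valid for $0\le i\le N$): (I$^+$) $b\ne0$, $b^*=0$, $c\neq0$, $c^*\neq0$; $\xi_i=x-q^{-1-N-M-i}(q-1)^2cc^*$, $\theta_i=a+bq^i+cq^{-i}$, $\theta^*_i=a^*+c^*q^{-i}$; (I$^-$) $b=0$, $b^*\ne0$, $c\neq0$, $c^*\neq0$; $\xi_i=x-q^{-1-N-M-i}(q-1)^2cc^*$, $\theta_i=a+cq^{-i}$, $\theta^*_i=a^*+b^*q^i+c^*q^{-i}$; (I$^0$) $b=b^*=0$, $c\neq0$, $c^*\neq0$; $\xi_i=x-q^{-1-N-M-i}(q-1)^2cc^*$, $\theta_i=a+cq^{-i}$, $\theta^*_i=a^*+c^*q^{-i}$; (II$^+$) $c\ne0$, $c^*=0$, $b\ne0$, $b^*\ne0$; $\xi_i=x-q^{-1-N-M-i}(q-1)^2bb^*$, $\theta_i=a+bq^{-i}+cq^{i}$, $\theta^*_i=a^*+b^*q^{-i}$; (II$^-$) $c=0$, $c^*\ne0$, $b\ne0$, $b^*\ne0$; $\xi_i=x-q^{-1-N-M-i}(q-1)^2bb^*$, $\theta_i=a+bq^{-i}$, $\theta^*_i=a^*+b^*q^{-i}+c^*q^{i}$; (II$^0$) $c=c^*=0$, $b\ne0$, $b^*\ne0$; $\xi_i=x-q^{-1-N-M-i}(q-1)^2bb^*$, $\theta_i=a+bq^{-i}$,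 $\theta^*_i=a^*+b^*q^{-i}$; (III$^+$) $x\ne0$, $b\neq0$, $b^*=0$, $c=0$, $c^*\neq0$; $\xi_i=x$, $\theta_i=a+bq^i$, $\theta^*_i=a^*+c^*q^{-i}$; (III$^-$) $x\ne0$, $b=0$, $b^*\neq0$, $c\neq0$, $c^*=0$; $\xi_i=x$, $\theta_i=a+cq^{-i}$, $\theta^*_i=a^*+b^*q^{i}$. Let $\beta,\gamma,\gamma^*,\varrho,\varrho^*$ be the complex scalars satisfying: $\beta+1=\frac{\theta_{i-2}-\theta_{i+1}}{\theta_{i-1}-\theta_i}=\frac{\theta^*_{i-2}-\theta^*_{i+1}}{\theta^*_{i-1}-\theta^*_i}$ for $2\le i\le N-1$; $\gamma=\theta_{i-1}-\beta\theta_i+\theta_{i+1}$ and $\gamma^*=\theta^*_{i-1}-\beta\theta^*_i+\theta^*_{i+1}$ for $1\le i\le N-1$; $\varrho=\theta_{i-1}^2-\beta\theta_{i-1}\theta_i+\theta_i^2-\gamma(\theta_{i-1}+\theta_i)$ and $\varrho^*=\theta_{i-1}^{*2}-\beta\theta^*_{i-1}\theta^*_i+\theta_i^{*2}-\gamma^*(\theta^*_{i-1}+\theta^*_i)$ for $1\le i\le N$. Then $B=0$ and $B^*=0$, where $B=[A,\,A^2A^*-\beta AA^*A+A^*A^2-\gamma(AA^*+A^*A)-\varrho A^*]$ and $B^*=[A^*,\,A^{*2}A-\beta A^*AA^*+AA^{*2}-\gamma^*(A^*A+AA^* )-\varrho^*A]$.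
   Context: Let $N\ge 6$ and $M\ge1$ be integers, let $\mathbb{F}_q$ be a finite field with $q$ elements. Let $H$ be an $(N+M)$-dimensional vector space over $\mathbb{F}_q$ and fix an $M$-dimensional subspace $h$ of $H$. Let $P$ be the set of subspaces $x$ of $H$ with $x\cap h=0$, partially ordered by inclusion, and for $0\le i\le N$ let $P_i$ be the set of elements of $P$ of dimension $i$. For $x,y\in P$ say $y$ covers $x$ if $x\subsetneq y$ and there is no $z\in P$ with $x\subsetneq z\subsetneq y$. Define $L,R\in\mathrm{Mat}_P(\mathbb{C})$ (complex matrices indexed by $P$) by $L_{xy}=1$ if $y$ covers $x$ and $0$ otherwise, $R_{xy}=1$ if $x$ covers $y$ and $0$ otherwise. For $0\le i\le N$ let $F_i$ be the diagonal matrix with $(F_i)_{yy}=1$ if $y\in P_i$ and $0$ otherwise. Let $A=\sum_{i=0}^{N-1}\alpha_iRF_i+\sum_{i=0}^N\theta_iF_i$ and $A^*=\sum_{i=1}^{N}\alpha^*_iLF_i+\sum_{i=0}^N\theta^*_iF_i$, where $\alpha_i,\alpha^*_i,\theta_i,\theta^*_i$ are complex scalars with $\alpha_i\ne0$ ($0\le i\le N-1$), $\alpha^*_i\neq0$ ($1\le i\le N$), $\theta_i\ne\theta_j$ and $\theta^*_i\ne\theta^*_j$ for $0\le i\neq j\le N$. Set $\xi_i=\alpha_i\alpha^*_{i+1}$ for $0\le i\le N-1$. $[r,s]=rs-sr$. *)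

theory Defs
  imports "HOL-Analysis.Analysis"
begin

definition att_poset :: "('f::field \<Rightarrow> 'v::ab_group_add \<Rightarrow> 'v) \<Rightarrow> 'v set \<Rightarrow> 'v set set" where
  "att_poset smul h = {x. module.subspace smul x \<and> x \<inter> h = {0}}"

definition att_level :: "('f::field \<Rightarrow> 'v::ab_group_add \<Rightarrow> 'v) \<Rightarrow> 'v set \<Rightarrow> nat \<Rightarrow> 'v set set" where
  "att_level smul h i = {x \<in> att_poset smul h. vector_space.dim smul x = i}"

text \<open>\<open>covers P y x\<close> means that \<open>y\<close> covers \<open>x\<close> in the family \<open>P\<close> of sets ordered by inclusion.\<close>

definition covers :: "'a set set \<Rightarrow> 'a set \<Rightarrow> 'a set \<Rightarrow> bool" where
  "covers P y x \<longleftrightarrow> x \<in> P \<and> y \<in> P \<and> x \<subset> y \<and> \<not> (\<exists>z\<in>P. x \<subset> z \<and> z \<subset> y)"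

text \<open>
  A complex matrix indexed by a family \<open>P\<close> of subsets of a finite type \<open>'v\<close> is encoded as a
  matrix indexed by all of \<open>'v set\<close> whose entries outside \<open>P \<times> P\<close> are zero. Such matrices are
  closed under sums, scalar multiples and products, and on them these operations (and the
  zero matrix) agree with those of \<open>Mat\<^sub>P(\<complex>)\<close>. The matrices defined below are all of this kind
  (the last one provided \<open>S \<subseteq> P\<close>). The algebra identity of \<open>Mat\<^sub>P(\<complex>)\<close> is not used.
\<close>

type_synonym 'v cmat = "complex ^ 'v set ^ 'v set"

definition lowering :: "'v::finite set set \<Rightarrow> 'v cmat" where
  "lowering P = (\<chi> x y. if covers P y x then 1 else 0)"

definition raising :: "'v::finite set set \<Rightarrow> 'v cmat" where
  "raising P = (\<chi> x y. if covers P x y then 1 else 0)"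

definition diag_indicator :: "'v::finite set set \<Rightarrow> 'v cmat" where
  "diag_indicator S = (\<chi> x y. if x = y \<and> y \<in> S then 1 else 0)"

text \<open>The library provides only real scalar multiples of complex matrices.\<close>

definition cscale :: "complex \<Rightarrow> complex ^ 'n ^ 'm \<Rightarrow> complex ^ 'n ^ 'm" (infixr "*\<^sub>C" 75) where
  "c *\<^sub>C X = (\<chi> i j. c * X $ i $ j)"

definition commutator :: "complex ^ 'n ^ 'n \<Rightarrow> complex ^ 'n ^ 'n \<Rightarrow> complex ^ 'n ^ 'n" where
  "commutator X Y = X ** Y - Y ** X"

end

theory Submission
  imports Defs
begin

text \<open>
  Call a vector homogeneous of degree \<open>i\<close> if it is supported on \<open>P\<^sub>i\<close>. On such vectors \<open>A\<close> acts as
  \<open>\<alpha>\<^sub>i R + \<theta>\<^sub>i\<close> and \<open>A\<^sup>*\<close> as \<open>\<alpha>\<^sup>*\<^sub>i L + \<theta>\<^sup>*\<^sub>i\<close>, so \<open>B v\<close> splits into components of degrees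
  \<open>i - 1, \<dots>, i + 3\<close>. All of them vanish by the recurrences for \<open>\<theta>\<close> and \<open>\<theta>\<^sup>*\<close> alone, except the one of degree
  \<open>i + 2\<close>, a combination of \<open>R\<^sup>3L, R\<^sup>2LR, RLR\<^sup>2, LR\<^sup>3\<close> and \<open>R\<^sup>2\<close>. That one is a combination
  \<open>s R U\<^sub>i + t U\<^sub>i\<^sub>+\<^sub>1 R\<close> of the relation
  \<open>U\<^sub>i: (q+1) R L R = q R\<^sup>2 L + L R\<^sup>2 + (q+1) q\<^bsup>N+M-1-i\<^esup> R\<close> on \<open>P\<^sub>i\<close>,
  with \<open>s = -\<xi>\<^sub>i\<^sub>-\<^sub>1/q\<close> and \<open>t = \<xi>\<^sub>i\<^sub>+\<^sub>2\<close>. The relation \<open>U\<^sub>i\<close> is proved entrywise by counting paths of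
  length three, according to the dimension of \<open>x \<inter> y\<close>.

  Cases II are cases I with \<open>b\<close>, \<open>c\<close> exchanged, and all cases reduce to
  \<open>\<theta>\<^sub>i = a + b q\<^sup>i + c q\<^bsup>-i\<^esup>\<close>, \<open>\<theta>\<^sup>*\<^sub>i = a\<^sup>* + b\<^sup>* q\<^sup>i + c\<^sup>* q\<^bsup>-i\<^esup>\<close>,
  \<open>\<xi>\<^sub>i = x - q\<^bsup>-1-N-M-i\<^esup>(q-1)\<^sup>2cc\<^sup>*\<close> and \<open>b b\<^sup>* = 0\<close>. These conditions are symmetric under
  transposition, which exchanges \<open>B\<close> and \<open>-B\<^sup>*\<close>.
\<close>

section \<open>Covers of subspaces over a finite field\<close>

locale finite_field_space = finite_dimensional_vector_space smul Basis
  for smul :: "'f::{field,finite} \<Rightarrow> 'v::{ab_group_add,finite} \<Rightarrow> 'v" and Basis +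
  fixes Q :: nat
  assumes Q_eq: "Q = CARD('f)"
begin

lemma Q_gt_1: "Q > 1"
proof -
  have "card {0, 1 :: 'f} \<le> Q"
    unfolding Q_eq by (intro card_mono) auto
  thus ?thesis by simp
qed

text \<open>Covering in the lattice of all subspaces, put in terms of dimension;
  \<open>covers_iff\<close> relates it to covering in \<open>P\<close>.\<close>

definition cov :: "'v set \<Rightarrow> 'v set \<Rightarrow> bool" where
  "cov x y \<longleftrightarrow> subspace x \<and> subspace y \<and> x \<subseteq> y \<and> dim y = Suc (dim x)"

lemma subspace_dim_eq: "subspace x \<Longrightarrow> subspace y \<Longrightarrow> x \<subseteq> y \<Longrightarrow> dim y \<le> dim x \<Longrightarrow> x = y"
  using subspace_dim_equal by blast

lemma dim_psubset_subspace: "subspace x \<Longrightarrow> subspace y \<Longrightarrow> x \<subset> y \<Longrightarrow> dim x < dim y"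
  by (metis dim_psubset span_eq_iff)

lemma dim_span_Un_Int:
  assumes "subspace x" "subspace y"
  shows "dim (span (x \<union> y)) + dim (x \<inter> y) = dim x + dim y"
proof -
  have "span (x \<union> y) = {a + b | a b. a \<in> x \<and> b \<in> y}"
    using assms by (simp add: span_Un span_eq_iff[THEN iffD2])
  thus ?thesis using dim_sums_Int[OF assms] by simp
qed

lemma cov_span_insert:
  assumes "subspace y" "u \<notin> y"
  shows "cov y (span (insert u y))"
proof -
  have "dim (span (insert u y)) = Suc (dim y)"
    using assms by (simp add: dim_insert span_eq_iff[THEN iffD2])
  thus ?thesis
    using assms by (auto simp: cov_def intro: span_base)
qed

lemma cov_eq_span_insert:
  assumes "cov y w" "u \<in> w" "u \<notin> y"
  shows "w = span (insert u y)"
proof -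
  have "span (insert u y) \<subseteq> w"
    using assms by (intro span_minimal) (auto simp: cov_def)
  thus ?thesis
    using cov_span_insert[of y u] assms subspace_dim_eq[of "span (insert u y)" w]
    by (auto simp: cov_def)
qed

text \<open>Adjoining a basis vector \<open>a\<close> multiplies the size by \<open>Q\<close>: the
  pair \<open>(k, u)\<close> is recovered from \<open>smul k a + u\<close> when \<open>a\<close>
  lies outside the span of the rest.\<close>

lemma card_subspace:
  assumes "subspace y"
  shows "card y = Q ^ dim y"
proof -
  have *: "card (span B) = Q ^ card B" if "independent B" "finite B" for B
    using that(2,1)
  proof (induction B)
    case (insert a B)
    have ind: "independent B" and a: "a \<notin> span B"
      using insert.prems insert.hyps by (auto simp: independent_insert)
    let ?f = "\<lambda>(k, u). smul k a + u"
    have "inj_on ?f (UNIV \<times> span B)"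
    proof (rule inj_onI, clarify)
      fix k u l v assume uv: "u \<in> span B" "v \<in> span B" and eq: "smul k a + u = smul l a + v"
      have "smul (k - l) a = v - u"
        using eq by (simp add: scale_left_diff_distrib algebra_simps)
      hence mem: "smul (k - l) a \<in> span B"
        using uv by (simp add: span_diff)
      have "k = l"
      proof (rule ccontr)
        assume "k \<noteq> l"
        hence "a = smul (inverse (k - l)) (smul (k - l) a)" by simp
        hence "a \<in> span B" using span_scale[OF mem] by metis
        thus False using a by simp
      qed
      thus "k = l \<and> u = v" using eq by simp
    qed
    moreover have "span (insert a B) = ?f ` (UNIV \<times> span B)"
    proof (intro equalityI subsetI)
      fix x assume "x \<in> span (insert a B)"
      then obtain k where "x - smul k a \<in> span B" by (auto simp: span_breakdown_eq)
      moreover have "x = ?f (k, x - smul k a)" by simp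
      ultimately show "x \<in> ?f ` (UNIV \<times> span B)" by blast
    next
      fix x assume "x \<in> ?f ` (UNIV \<times> span B)"
      then obtain k u where "x = smul k a + u" "u \<in> span B" by auto
      thus "x \<in> span (insert a B)" by (auto simp: span_breakdown_eq intro!: exI[of _ k])
    qed
    ultimately have "card (span (insert a B)) = Q * card (span B)"
      by (simp add: card_image card_cartesian_product Q_eq)
    thus ?case using insert ind by simp
  qed simp
  obtain B where "finite B" "independent B" "span B = y" "card B = dim y"
    using basis_subspace_exists[OF assms] by metis
  thus ?thesis using * by metis
qed

section \<open>Counting covers by counting vectors\<close>

lemma card_cov_diff:
  assumes "cov y w"
  shows "card (w - y) = Q ^ dim y * (Q - 1)"
proof -
  have "card (w - y) = card w - card y"
    using assms by (intro card_Diff_subset) (auto simp: cov_def)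
  thus ?thesis
    using assms by (simp add: card_subspace cov_def algebra_simps)
qed

text \<open>Double counting: a cover of \<open>y\<close> is determined by any of its vectors outside
  \<open>y\<close>, and \<open>sat\<close> puts whole sets \<open>w - y\<close> into
  \<open>S\<close>, so \<open>S\<close> is a disjoint union of such sets, all of one size.\<close>

lemma card_covers_in:
  assumes y: "subspace y" and S: "S \<inter> y = {}"
    and sat: "\<And>u. u \<in> S \<Longrightarrow> span (insert u y) - y \<subseteq> S"
  shows "card S = card {w. cov y w \<and> w - y \<subseteq> S} * (Q ^ dim y * (Q - 1))"
proof -
  let ?W = "{w. cov y w \<and> w - y \<subseteq> S}"
  have "S = (\<Union>w\<in>?W. w - y)"
  proof (intro equalityI subsetI)
    fix u assume u: "u \<in> S"
    hence "u \<notin> y" using S by auto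
    hence "span (insert u y) \<in> ?W" using cov_span_insert[OF y] sat[OF u] by auto
    moreover have "u \<in> span (insert u y) - y" using \<open>u \<notin> y\<close> by (simp add: span_base)
    ultimately show "u \<in> (\<Union>w\<in>?W. w - y)" by blast
  qed auto
  also have "card \<dots> = (\<Sum>w\<in>?W. card (w - y))"
  proof (intro card_UN_disjoint ballI impI)
    fix v w assume "v \<in> ?W" "w \<in> ?W" "v \<noteq> w"
    thus "(v - y) \<inter> (w - y) = {}"
      using cov_eq_span_insert by blast
  qed auto
  also have "\<dots> = card ?W * (Q ^ dim y * (Q - 1))"
    by (simp add: card_cov_diff)
  finally show ?thesis .
qed

lemma card_between:
  assumes "subspace z" "subspace x" "z \<subseteq> x" "dim x = dim z + 2"
  shows "card {w. cov z w \<and> cov w x} = Q + 1"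
proof -
  let ?k = "dim z"
  have eq: "{w. cov z w \<and> w - z \<subseteq> x - z} = {w. cov z w \<and> cov w x}"
    using assms by (auto simp: cov_def)
  have "card (x - z) = Q ^ (?k + 2) - Q ^ ?k"
    using assms by (simp add: card_Diff_subset card_subspace)
  also have "\<dots> = (Q + 1) * (Q ^ ?k * (Q - 1))"
    using Q_gt_1 by (simp add: algebra_simps)
  moreover have "card (x - z) = card {w. cov z w \<and> w - z \<subseteq> x - z} * (Q ^ ?k * (Q - 1))"
  proof (rule card_covers_in)
    fix u assume "u \<in> x - z"
    hence "span (insert u z) \<subseteq> x" using assms by (intro span_minimal) auto
    thus "span (insert u z) - z \<subseteq> x - z" by auto
  qed (use assms in auto)
  ultimately have "card {w. cov z w \<and> cov w x} * (Q ^ ?k * (Q - 1)) = (Q + 1) * (Q ^ ?k * (Q - 1))"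
    by (simp only: eq)
  thus ?thesis using Q_gt_1 by (simp only: mult_cancel2) simp
qed

section \<open>Modularity of the subspace lattice and the number of hyperplanes\<close>

lemma cov_Int:
  assumes "cov z x" "cov y x" "z \<noteq> y"
  shows "cov (z \<inter> y) y" "cov (z \<inter> y) z" "span (z \<union> y) = x"
proof -
  have s: "subspace z" "subspace y" "subspace x" "z \<subseteq> x" "y \<subseteq> x" "dim x = Suc (dim z)" "dim y = dim z"
    using assms by (auto simp: cov_def)
  have sub: "span (z \<union> y) \<subseteq> x"
    using s by (intro span_minimal) auto
  have "\<not> y \<subseteq> z" using subspace_dim_eq[of y z] s assms by auto
  hence "z \<subset> span (z \<union> y)" using span_base[of _ "z \<union> y"] by blast
  hence "dim z < dim (span (z \<union> y))" using s by (intro dim_psubset_subspace) auto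
  thus *: "span (z \<union> y) = x" using s sub subspace_dim_eq[of "span (z \<union> y)" x] by auto
  show "cov (z \<inter> y) y" "cov (z \<inter> y) z"
    using dim_span_Un_Int[of z y] s unfolding * by (auto simp: cov_def subspace_inter)
qed

lemma cov_span_Un:
  assumes "cov u z" "cov u y" "z \<noteq> y"
  shows "cov y (span (z \<union> y))" "cov z (span (z \<union> y))" "z \<inter> y = u"
proof -
  have s: "subspace z" "subspace y" "subspace u" "u \<subseteq> z" "u \<subseteq> y" "dim y = Suc (dim u)" "dim y = dim z"
    using assms by (auto simp: cov_def)
  have "\<not> z \<subseteq> y" using subspace_dim_eq[of z y] s assms by auto
  hence "z \<inter> y \<subset> z" by blast
  hence "dim (z \<inter> y) < dim z" using s by (intro dim_psubset_subspace) (auto simp: subspace_inter)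
  thus *: "z \<inter> y = u" using s subspace_dim_eq[of u "z \<inter> y"] by (auto simp: subspace_inter)
  show "cov y (span (z \<union> y))" "cov z (span (z \<union> y))"
    using dim_span_Un_Int[of z y] s unfolding * by (auto simp: cov_def intro: span_base)
qed

text \<open>Hyperplanes \<open>z\<close> other than \<open>y\<close> are sorted by
  \<open>u = z \<inter> y\<close>, a hyperplane of \<open>y\<close>: the interval from
  \<open>u\<close> to \<open>x\<close> has \<open>Q + 1\<close> inner members, one of which is
  \<open>y\<close>.\<close>

lemma card_hyperplanes:
  assumes yx: "cov y x"
  shows "card {z. cov z x} = 1 + Q * card {u. cov u y}"
proof -
  let ?U = "{u. cov u y}" and ?B = "\<lambda>u. {z. cov u z \<and> cov z x} - {y}"
  have eq: "{z. cov z x} = insert y (\<Union>u\<in>?U. ?B u)"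
    using yx cov_Int[OF _ yx] by auto
  have "card (\<Union>u\<in>?U. ?B u) = (\<Sum>u\<in>?U. card (?B u))"
  proof (intro card_UN_disjoint ballI impI)
    fix u v assume "u \<in> ?U" "v \<in> ?U" "u \<noteq> v"
    thus "?B u \<inter> ?B v = {}"
      using cov_span_Un(3)[of u _ y] cov_span_Un(3)[of v _ y] by blast
  qed auto
  also have "\<dots> = (\<Sum>u\<in>?U. Q)"
  proof (rule sum.cong)
    fix u assume u: "u \<in> ?U"
    have "card {z. cov u z \<and> cov z x} = Q + 1"
      using u yx by (intro card_between) (auto simp: cov_def)
    thus "card (?B u) = Q" using u yx by (subst card_Diff_singleton) auto
  qed simp
  finally have "card (\<Union>u\<in>?U. ?B u) = Q * card ?U" by simp
  thus ?thesis unfolding eq by (subst card_insert_disjoint) auto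
qed

end

section \<open>The poset of an attenuated space\<close>

locale attenuated_space = finite_field_space smul Basis Q
  for smul :: "'f::{field,finite} \<Rightarrow> 'v::{ab_group_add,finite} \<Rightarrow> 'v" and Basis Q +
  fixes h :: "'v set" and N M :: nat
  assumes h: "subspace h" "dim h = M" and dimH: "dim (UNIV :: 'v set) = N + M"
begin

abbreviation P :: "'v set set" where "P \<equiv> att_poset smul h"

lemma P_iff: "x \<in> P \<longleftrightarrow> subspace x \<and> x \<inter> h = {0}"
  by (simp add: att_poset_def)

lemma P_downward: "x \<in> P \<Longrightarrow> subspace y \<Longrightarrow> y \<subseteq> x \<Longrightarrow> y \<in> P"
  using subspace_0[of y] subspace_0[OF h(1)] by (auto simp: P_iff)

lemma dim_P: "x \<in> P \<Longrightarrow> dim x \<le> N"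
  using dim_span_Un_Int[of x h] dim_subset[of "span (x \<union> h)" UNIV] h dimH
  by (auto simp: P_iff)

text \<open>\<open>P\<close> is closed under passing to subspaces, so a cover of \<open>x\<close> in
  \<open>P\<close> must already be spanned by \<open>x\<close> and one further vector.\<close>

lemma covers_iff: "covers P y x \<longleftrightarrow> x \<in> P \<and> y \<in> P \<and> cov x y"
proof (cases "x \<in> P \<and> y \<in> P")
  case True
  hence s: "subspace x" "subspace y" by (auto simp: P_iff)
  show ?thesis
  proof
    assume c: "covers P y x"
    then obtain u where u: "u \<in> y" "u \<notin> x" by (auto simp: covers_def)
    have "x \<subset> span (insert u x)" using u by (auto intro: span_base)
    moreover have sub: "span (insert u x) \<subseteq> y"
      using c u s by (intro span_minimal) (auto simp: covers_def)
    moreover have "span (insert u x) \<in> P" using True sub P_downward by auto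
    ultimately have "span (insert u x) = y" using c by (auto simp: covers_def)
    thus "x \<in> P \<and> y \<in> P \<and> cov x y" using True cov_span_insert[OF s(1) u(2)] by auto
  next
    assume c: "x \<in> P \<and> y \<in> P \<and> cov x y"
    have "\<not> (x \<subset> z \<and> z \<subset> y)" if "z \<in> P" for z
    proof
      assume *: "x \<subset> z \<and> z \<subset> y"
      have "subspace z" using that by (simp add: P_iff)
      hence "dim x < dim z" "dim z < dim y" using * s dim_psubset_subspace by auto
      thus False using c by (simp add: cov_def)
    qed
    thus "covers P y x" using c by (auto simp: covers_def cov_def)
  qed
qed (auto simp: covers_def)

section \<open>Counting covers inside \<open>P\<close>\<close>

text \<open>A cover \<open>w\<close> of \<open>y\<close> lies in \<open>P\<close> exactly when
  \<open>w - y\<close> avoids \<open>y + h\<close>, so the admissible vectors are those outside a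
  subspace of dimension \<open>M + dim y\<close>.\<close>

lemma card_covers_P:
  assumes y: "y \<in> P"
  shows "card {w \<in> P. cov y w} * (Q ^ dim y * (Q - 1)) = Q ^ (N + M) - Q ^ (M + dim y)"
proof -
  let ?s = "span (y \<union> h)"
  have sy: "subspace y" "y \<inter> h = {0}" using y by (auto simp: P_iff)
  have s: "?s = {a + b | a b. a \<in> y \<and> b \<in> h}"
    using sy h by (simp add: span_Un span_eq_iff[THEN iffD2])
  have dims: "dim ?s = M + dim y"
    using dim_span_Un_Int[OF sy(1) h(1)] sy h by simp
  have eq: "{w. cov y w \<and> w - y \<subseteq> UNIV - ?s} = {w \<in> P. cov y w}"
  proof (intro Collect_cong iffI conjI)
    fix w assume w: "cov y w \<and> w - y \<subseteq> UNIV - ?s"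
    have "t = 0" if "t \<in> w" "t \<in> h" for t
    proof (rule ccontr)
      assume "t \<noteq> 0"
      hence "t \<in> w - y" using that sy by auto
      thus False using w that span_base[of t "y \<union> h"] by auto
    qed
    thus "w \<in> P" using w h subspace_0 by (auto simp: P_iff cov_def)
  next
    fix w assume w: "w \<in> P \<and> cov y w"
    show "w - y \<subseteq> UNIV - ?s"
    proof (intro subsetI DiffI UNIV_I notI)
      fix t assume "t \<in> w - y" "t \<in> ?s"
      hence t: "t \<in> w" "t \<notin> y" "t \<in> ?s" by auto
      then obtain a b where ab: "t = a + b" "a \<in> y" "b \<in> h" using s by auto
      have "a \<in> w" using w ab by (auto simp: cov_def)
      hence "b \<in> w" using subspace_diff[of w t a] t w ab by (auto simp: cov_def)
      hence "b = 0" using w ab by (auto simp: P_iff)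
      thus False using ab t by simp
    qed
  qed auto
  have "card (UNIV - ?s) = card {w. cov y w \<and> w - y \<subseteq> UNIV - ?s} * (Q ^ dim y * (Q - 1))"
  proof (rule card_covers_in)
    fix u assume u: "u \<in> UNIV - ?s"
    show "span (insert u y) - y \<subseteq> UNIV - ?s"
    proof (intro subsetI DiffI UNIV_I notI)
      fix t assume "t \<in> span (insert u y) - y" "t \<in> ?s"
      hence t: "t \<in> span (insert u y)" "t \<notin> y" "t \<in> ?s" by auto
      \<comment> \<open>Exchange: \<open>t\<close> lies in the span of \<open>u\<close> and
        \<open>y\<close> but not in \<open>y\<close>, so \<open>u\<close> lies in the span of
        \<open>t\<close> and \<open>y\<close>, hence in \<open>y + h\<close>.\<close>
      hence "u \<in> span (insert t y)" using in_span_insert[of t u y] sy by (simp add: span_eq_iff[THEN iffD2])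
      moreover have "span (insert t y) \<subseteq> ?s"
        using t by (intro span_minimal) (auto intro: span_base)
      ultimately show False using u by auto
    qed
  qed (use sy in \<open>auto intro: span_base\<close>)
  moreover have "card (UNIV - ?s) = Q ^ (N + M) - Q ^ (M + dim y)"
    using dims dimH card_subspace[of UNIV] card_subspace[of ?s] by (simp add: card_Diff_subset)
  ultimately show ?thesis unfolding eq by simp
qed

text \<open>\<open>Q\<close> times the count for \<open>y\<close> minus the count for
  \<open>x\<close> cancels the powers of \<open>Q\<close> with exponent
  \<open>M + Suc (dim y)\<close>. The surplus becomes the \<open>R\<close> term of
  \<open>U\<^sub>i\<close>.\<close>

lemma card_covers_step:
  assumes "cov y x" "x \<in> P" "y \<in> P"
  shows "card {w \<in> P. cov y w} = card {w \<in> P. cov x w} + Q ^ (N + M - 1 - dim y)"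
proof -
  let ?i = "dim y"
  have d: "dim x = Suc ?i" using assms by (auto simp: cov_def)
  have i: "Suc ?i \<le> N" using dim_P[OF assms(2)] d by simp
  let ?a = "card {w \<in> P. cov y w}" and ?b = "card {w \<in> P. cov x w}"
  have exp: "(N + M - 1 - ?i) + Suc ?i = N + M" using i by simp
  have A: "?a * (Q ^ ?i * (Q - 1)) + Q ^ (M + ?i) = Q ^ (N + M)"
    using card_covers_P[OF assms(3)] i Q_gt_1 power_increasing[of "M + ?i" "N + M" Q] by simp
  have B: "?b * (Q ^ Suc ?i * (Q - 1)) + Q ^ (M + Suc ?i) = Q ^ (N + M)"
    using card_covers_P[OF assms(2)] i Q_gt_1 power_increasing[of "M + Suc ?i" "N + M" Q]
    unfolding d by (simp del: power_Suc add_Suc_right)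
  have E: "Q ^ (N + M - 1 - ?i) * (Q ^ Suc ?i) = Q ^ (N + M)"
    by (metis exp power_add)
  define r where "r = Q - 1"
  have Qr: "Q = r + 1" using Q_gt_1 by (simp add: r_def)
  have "?a * (Q ^ Suc ?i * r) + Q ^ (M + Suc ?i) = Q * Q ^ (N + M)"
    using arg_cong[OF A[folded r_def], of "\<lambda>t. Q * t"] by (simp add: algebra_simps)
  also have "\<dots> = r * Q ^ (N + M) + Q ^ (N + M)" by (subst (1) Qr) (simp add: algebra_simps)
  also have "\<dots> = r * (Q ^ (N + M - 1 - ?i) * Q ^ Suc ?i) + (?b * (Q ^ Suc ?i * r) + Q ^ (M + Suc ?i))"
    unfolding E r_def using B by simp
  finally have "?a * (Q ^ Suc ?i * r) = (?b + Q ^ (N + M - 1 - ?i)) * (Q ^ Suc ?i * r)"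
    by (simp add: algebra_simps)
  moreover have "Q ^ Suc ?i * r \<noteq> 0" using Q_gt_1 by (simp add: r_def)
  ultimately show ?thesis by (simp only: mult_cancel2) simp
qed

section \<open>Paths of length three between adjacent levels\<close>

text \<open>The paths counted by the \<open>(x, y)\<close> entries of \<open>R\<^sup>2L\<close>, \<open>RLR\<close>, \<open>LR\<^sup>2\<close>; subspaces of members of
  \<open>P\<close> lie in \<open>P\<close>, so only the top of a path needs to be restricted to \<open>P\<close>.\<close>

definition "paths_RRL x y = {(w, z). cov z y \<and> cov z w \<and> cov w x}"
definition "paths_RLR x y = {(w, z). w \<in> P \<and> cov y w \<and> cov z w \<and> cov z x}"
definition "paths_LRR x y = {(w, z). w \<in> P \<and> cov y z \<and> cov z w \<and> cov x w}"

text \<open>RRL gives \<open>(Q + 1) * ?H\<close>, LRR gives \<open>Q + 1\<close> times the covers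
  of \<open>x\<close> in \<open>P\<close>, and RLR gives \<open>Q * ?H\<close> plus the covers of
  \<open>y\<close> in \<open>P\<close>; \<open>card_covers_step\<close> compares the covers.\<close>

lemma path_counts_cov:
  assumes yx: "cov y x" and P: "x \<in> P" "y \<in> P"
  shows "(Q + 1) * card (paths_RLR x y) = Q * card (paths_RRL x y) + card (paths_LRR x y)
    + (Q + 1) * Q ^ (N + M - 1 - dim y)"
proof -
  let ?H = "card {z. cov z y}"
  have "paths_RRL x y = (\<lambda>(z, w). (w, z)) ` (SIGMA z:{z. cov z y}. {w. cov z w \<and> cov w x})"
    by (auto simp: paths_RRL_def)
  hence "card (paths_RRL x y) = card (SIGMA z:{z. cov z y}. {w. cov z w \<and> cov w x})"
    by (simp add: card_image inj_on_def)
  also have "\<dots> = (\<Sum>z\<in>{z. cov z y}. card {w. cov z w \<and> cov w x})"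
    by (simp add: card_SigmaI)
  also have "\<dots> = (\<Sum>z\<in>{z. cov z y}. Q + 1)"
    by (intro sum.cong refl card_between) (use yx in \<open>auto simp: cov_def\<close>)
  finally have RRL: "card (paths_RRL x y) = ?H * (Q + 1)" by simp
  have "paths_LRR x y = (SIGMA w:{w \<in> P. cov x w}. {z. cov y z \<and> cov z w})"
    by (auto simp: paths_LRR_def)
  hence "card (paths_LRR x y) = (\<Sum>w\<in>{w \<in> P. cov x w}. card {z. cov y z \<and> cov z w})"
    by (simp add: card_SigmaI)
  also have "\<dots> = (\<Sum>w\<in>{w \<in> P. cov x w}. Q + 1)"
    by (intro sum.cong refl card_between) (use yx in \<open>auto simp: cov_def\<close>)
  finally have LRR: "card (paths_LRR x y) = card {w \<in> P. cov x w} * (Q + 1)" by simp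
  \<comment> \<open>Distinct hyperplanes \<open>z\<close> and \<open>y\<close> of both
    \<open>w\<close> and \<open>x\<close> span each of these, so an RLR path has
    \<open>z = y\<close> or \<open>w = x\<close>.\<close>
  have "w = x" if "cov y w" "cov z w" "cov z x" "z \<noteq> y" for w z
    using cov_Int(3)[of z w y] cov_Int(3)[of z x y] that yx by auto
  hence "paths_RLR x y = ({w \<in> P. cov y w} \<times> {y}) \<union> ({x} \<times> ({z. cov z x} - {y}))"
    using yx P by (auto simp: paths_RLR_def)
  hence "card (paths_RLR x y) = card {w \<in> P. cov y w} + (card ({z. cov z x} - {y}))"
    by (simp add: card_Un_disjoint card_cartesian_product_singleton card_cartesian_product disjoint_iff)
  also have "card ({z. cov z x} - {y}) = Q * ?H"
    using yx card_hyperplanes[OF yx] by (subst card_Diff_singleton) auto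
  finally show ?thesis
    unfolding RRL LRR card_covers_step[OF yx P] by (simp add: algebra_simps)
qed

text \<open>RRL forces \<open>z = m\<close>, LRR forces \<open>w = s\<close>, and in RLR the choice
  of \<open>z\<close> between \<open>m\<close> and \<open>x\<close> determines
  \<open>w = span (z \<union> y)\<close>. If \<open>s\<close> is in \<open>P\<close>, all three
  counts are \<open>Q + 1\<close>; otherwise RLR, RRL, LRR have \<open>Q\<close>,
  \<open>Q + 1\<close>, \<open>0\<close> paths.\<close>

lemma path_counts_adjacent:
  assumes P: "x \<in> P" "y \<in> P" and d: "dim x = Suc (dim y)" and my: "cov (x \<inter> y) y"
  shows "(Q + 1) * card (paths_RLR x y) = Q * card (paths_RRL x y) + card (paths_LRR x y)"
proof -
  define m where "m = x \<inter> y"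
  define s where "s = span (x \<union> y)"
  let ?Z = "{z. cov m z \<and> cov z x}"
  have sub: "subspace x" "subspace y" "subspace m" "subspace s" "m \<subseteq> x" "m \<subseteq> y" "x \<subseteq> s" "y \<subseteq> s"
    using P by (auto simp: P_iff m_def s_def subspace_inter intro: span_base)
  have dm: "dim y = Suc (dim m)" using my by (auto simp: cov_def m_def)
  have ds: "dim s = Suc (dim x)"
    using dim_span_Un_Int[of x y] sub dm by (simp add: s_def m_def)
  have nyx: "\<not> y \<subseteq> x" using dm by (auto simp: m_def Int_absorb1)
  have xs: "cov x s" using sub ds by (auto simp: cov_def)
  have Z: "card ?Z = Q + 1"
    using sub d dm by (intro card_between) auto
  have "z = m" if "cov z y" "cov z w" "cov w x" for w z
  proof (rule subspace_dim_eq)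
    show "z \<subseteq> m" using that by (auto simp: cov_def m_def)
  qed (use that sub dm in \<open>auto simp: cov_def\<close>)
  hence "paths_RRL x y = ?Z \<times> {m}"
    using my by (auto simp: paths_RRL_def m_def)
  hence RRL: "card (paths_RRL x y) = Q + 1"
    using Z by (simp add: card_cartesian_product)
  have Zy: "z \<noteq> y" if "cov z x" for z using that nyx by (auto simp: cov_def)
  have my': "cov m y" using my by (simp add: m_def)
  have join: "cov y (span (z \<union> y))" "cov z (span (z \<union> y))" "span (z \<union> y) \<subseteq> s" if z: "z \<in> ?Z" for z
  proof -
    show "cov y (span (z \<union> y))" "cov z (span (z \<union> y))"
      using cov_span_Un[of m z y] z my' Zy by auto
    show "span (z \<union> y) \<subseteq> s"
      using z sub by (intro span_minimal) (auto simp: cov_def)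
  qed
  have "paths_RLR x y = (\<lambda>z. (span (z \<union> y), z)) ` {z \<in> ?Z. span (z \<union> y) \<in> P}"
  proof (intro equalityI subsetI)
    fix p assume "p \<in> paths_RLR x y"
    then obtain w z where p: "p = (w, z)" "w \<in> P" "cov y w" "cov z w" "cov z x"
      by (auto simp: paths_RLR_def)
    have c: "cov (z \<inter> y) y" "cov (z \<inter> y) z" "span (z \<union> y) = w"
      using cov_Int[of z w y] Zy p by auto
    have "z \<inter> y = m"
      using subspace_dim_eq[of "z \<inter> y" m] sub c(1) dm p by (auto simp: cov_def m_def)
    hence "z \<in> {z \<in> ?Z. span (z \<union> y) \<in> P}" "p = (span (z \<union> y), z)" using c p by auto
    thus "p \<in> (\<lambda>z. (span (z \<union> y), z)) ` {z \<in> ?Z. span (z \<union> y) \<in> P}" by blast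
  qed (use join in \<open>auto simp: paths_RLR_def\<close>)
  hence RLR: "card (paths_RLR x y) = card {z \<in> ?Z. span (z \<union> y) \<in> P}"
    by (simp add: card_image inj_on_def)
  have w_s: "w = s" if "cov y z" "cov z w" "cov x w" for w z
  proof -
    have "s \<subseteq> w" unfolding s_def using that by (intro span_minimal) (auto simp: cov_def)
    thus ?thesis using subspace_dim_eq[of s w] that sub ds by (auto simp: cov_def)
  qed
  show ?thesis
  proof (cases "s \<in> P")
    case True
    have "paths_LRR x y = {s} \<times> {z. cov y z \<and> cov z s}"
      using True w_s xs by (auto simp: paths_LRR_def)
    moreover have "card {z. cov y z \<and> cov z s} = Q + 1"
      using sub d ds by (intro card_between) auto
    ultimately have LRR: "card (paths_LRR x y) = Q + 1"
      by (simp add: card_cartesian_product)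
    have "{z \<in> ?Z. span (z \<union> y) \<in> P} = ?Z"
      using join(3) P_downward[OF True] by auto
    hence "card (paths_RLR x y) = Q + 1" using RLR Z by simp
    thus ?thesis unfolding LRR RRL by (simp add: algebra_simps)
  next
    case False
    have LRR: "paths_LRR x y = {}" using False w_s by (auto simp: paths_LRR_def)
    obtain t where t: "t \<in> s" "t \<in> h" "t \<noteq> 0"
      using False sub h subspace_0 by (auto simp: P_iff)
    have tx: "t \<notin> x" "t \<notin> y" using t P by (auto simp: P_iff)
    \<comment> \<open>The cover of \<open>y\<close> through a nonzero vector of
      \<open>s \<inter> h\<close>, hence outside \<open>P\<close>; \<open>z0 = v \<inter> x\<close>
      is the \<open>z\<close> whose join with \<open>y\<close> is \<open>v\<close>.\<close>
    define v where "v = span (insert t y)"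
    have v: "cov y v" unfolding v_def using sub tx by (intro cov_span_insert)
    have vs: "v \<subseteq> s" unfolding v_def using sub t by (intro span_minimal) auto
    have vx: "v \<noteq> x" using v nyx by (auto simp: cov_def)
    have "cov v s" using v vs sub d ds by (auto simp: cov_def)
    note c0 = cov_Int[OF this xs vx]
    define z0 where "z0 = v \<inter> x"
    have z0: "cov z0 x" "cov z0 v" using c0 by (auto simp: z0_def)
    have mz0: "m \<subseteq> z0" using v by (auto simp: z0_def m_def cov_def)
    have z0Z: "z0 \<in> ?Z" using z0 mz0 sub d dm by (auto simp: cov_def)
    have "span (z0 \<union> y) = v"
      using cov_Int(3)[of z0 v y] z0 v Zy by auto
    moreover have tv: "t \<in> v" by (simp add: v_def span_base)
    ultimately have n0: "span (z0 \<union> y) \<notin> P" using t by (auto simp: P_iff)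
    have "z = z0" if z: "z \<in> ?Z" and nP: "span (z \<union> y) \<notin> P" for z
    proof -
      let ?j = "span (z \<union> y)"
      obtain t' where t': "t' \<in> ?j" "t' \<in> h" "t' \<noteq> 0"
        using nP h subspace_0 by (auto simp: P_iff)
      have t'x: "t' \<notin> x" using t' P by (auto simp: P_iff)
      \<comment> \<open>\<open>s\<close> has one dimension more than \<open>x\<close>, and
        \<open>x\<close> meets \<open>h\<close> trivially, so \<open>t\<close> is a multiple of
        \<open>t'\<close>; thus \<open>?j\<close> contains \<open>t\<close> and equals
        \<open>v\<close>.\<close>
      have "s = span (insert t' x)"
        using cov_eq_span_insert[OF xs _ t'x] join(3)[OF z] t' by auto
      then obtain k where k: "t - smul k t' \<in> x"
        using t sub by (auto simp: span_breakdown_eq span_eq_iff[THEN iffD2])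
      moreover have "t - smul k t' \<in> h"
        using t t' h by (intro subspace_diff subspace_scale)
      ultimately have "t - smul k t' \<in> x \<inter> h" by simp
      moreover have "x \<inter> h = {0}" using P by (simp add: P_iff)
      ultimately have "t = smul k t'" by simp
      hence "t \<in> ?j" using t' by (simp add: span_scale)
      hence "?j = v" unfolding v_def using join(1)[OF z] tx by (intro cov_eq_span_insert)
      hence "z \<subseteq> z0" using z span_base[of _ "z \<union> y"] by (auto simp: z0_def cov_def)
      thus ?thesis using subspace_dim_eq[of z z0] z z0 by (auto simp: cov_def)
    qed
    \<comment> \<open>as \<open>s \<inter> h\<close> is one-dimensional, exactly one \<open>z\<close> fails\<close>
    hence "{z \<in> ?Z. span (z \<union> y) \<in> P} = ?Z - {z0}" using n0 by auto
    hence "card (paths_RLR x y) = Q" using RLR Z z0Z by (simp add: card_Diff_singleton)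
    thus ?thesis unfolding LRR RRL by (simp add: algebra_simps)
  qed
qed

text \<open>Every path would make \<open>x \<inter> y\<close> too large: through \<open>z\<close> in
  RRL, through \<open>z \<inter> y\<close> in RLR, and through the dimension formula in LRR, where
  \<open>w\<close> contains \<open>x + y\<close>.\<close>

lemma path_counts_distant:
  assumes P: "x \<in> P" "y \<in> P" and d: "dim x = Suc (dim y)"
    and ncov: "\<not> cov y x" "\<not> cov (x \<inter> y) y"
  shows "paths_RLR x y = {}" "paths_RRL x y = {}" "paths_LRR x y = {}"
proof -
  have sub: "subspace x" "subspace y" "subspace (x \<inter> y)" using P by (auto simp: P_iff subspace_inter)
  have "\<not> y \<subseteq> x" using ncov sub d by (auto simp: cov_def)
  hence "x \<inter> y \<subset> y" by auto
  hence lt: "dim (x \<inter> y) < dim y" using sub by (intro dim_psubset_subspace)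
  hence dd: "Suc (dim (x \<inter> y)) < dim y" using ncov sub by (auto simp: cov_def)
  have no: False if "subspace z" "z \<subseteq> x" "z \<subseteq> y" "dim y \<le> Suc (dim z)" for z
    using that dd dim_subset[of z "x \<inter> y"] by auto
  show "paths_RRL x y = {}"
    using no by (fastforce simp: paths_RRL_def cov_def)
  have "False" if "cov y w" "cov z w" "cov z x" for w z
  proof (cases "z = y")
    case True thus False using that ncov by simp
  next
    case False
    from cov_Int(1)[OF that(2,1) this] that show False
      by (intro no[of "z \<inter> y"]) (auto simp: cov_def)
  qed
  thus "paths_RLR x y = {}" by (auto simp: paths_RLR_def)
  have "False" if "cov y z" "cov z w" "cov x w" for w z
  proof -
    have "span (x \<union> y) \<subseteq> w" using that by (intro span_minimal) (auto simp: cov_def)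
    hence "dim (span (x \<union> y)) \<le> dim w" by (intro dim_subset)
    thus False using dim_span_Un_Int[of x y] sub that dd d by (auto simp: cov_def)
  qed
  thus "paths_LRR x y = {}" by (auto simp: paths_LRR_def)
qed

lemma path_counts:
  assumes "x \<in> P" "y \<in> P" "dim x = Suc (dim y)"
  shows "(Q + 1) * card (paths_RLR x y) = Q * card (paths_RRL x y) + card (paths_LRR x y)
    + (if cov y x then (Q + 1) * Q ^ (N + M - 1 - dim y) else 0)"
proof (cases "cov y x")
  case True
  thus ?thesis using path_counts_cov[OF True assms(1,2)] by simp
next
  case ncov: False
  show ?thesis
  proof (cases "cov (x \<inter> y) y")
    case True
    thus ?thesis using path_counts_adjacent[OF assms True] ncov by simp
  next
    case False
    note path_counts_distant[OF assms ncov False]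
    thus ?thesis using ncov by simp
  qed
qed

end

section \<open>Sequences with terms \<open>a + b q\<^sup>i + c q\<^bsup>-i\<^esup>\<close>\<close>

text \<open>Integer indices allow shifts to \<open>i - 1\<close> without boundary cases.\<close>

definition qseq :: "complex \<Rightarrow> complex \<Rightarrow> complex \<Rightarrow> complex \<Rightarrow> int \<Rightarrow> complex" where
  "qseq q a b c i = a + b * q powi i + c * q powi (- i)"

context
  fixes q :: complex
  assumes q: "q \<noteq> 0"
begin

lemma qseq_at: "qseq q a b c i = a + b * q powi i + c / q powi i"
  using q by (simp add: qseq_def power_int_minus inverse_eq_divide)

lemma qseq_shift:
  "qseq q a b c (i + 1) = a + b * (q powi i * q) + c / (q powi i * q)"
  "qseq q a b c (i + 2) = a + b * (q powi i * q^2) + c / (q powi i * q^2)"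
  "qseq q a b c (i + 3) = a + b * (q powi i * q^3) + c / (q powi i * q^3)"
  "qseq q a b c (i - 1) = a + b * (q powi i / q) + c / (q powi i / q)"
  using q by (simp_all add: qseq_def power_int_minus power_int_add power_int_diff inverse_eq_divide
      flip: add.commute[of i])

text \<open>The operator annihilates \<open>q powi i\<close> and \<open>q powi (- i)\<close>, so
  only the constant \<open>a\<close> contributes.\<close>

lemma qseq_\<gamma>: "qseq q a b c (i - 1) - (q + 1 / q) * qseq q a b c i + qseq q a b c (i + 1) = a * (2 - (q + 1 / q))"
  using q unfolding qseq_shift qseq_at[where i = i] by (simp add: field_simps power2_eq_square)

lemma qseq_\<beta>: "qseq q a b c i - (q + 1 / q + 1) * qseq q a b c (i + 1)
    + (q + 1 / q + 1) * qseq q a b c (i + 2) - qseq q a b c (i + 3) = 0"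
  using q unfolding qseq_shift qseq_at[where i = i] by (simp add: field_simps eval_nat_numeral)

lemma qseq_\<rho>: "(qseq q a b c i)^2 - (q + 1 / q) * qseq q a b c i * qseq q a b c (i + 1) + (qseq q a b c (i + 1))^2
    - a * (2 - (q + 1 / q)) * (qseq q a b c i + qseq q a b c (i + 1))
   = b * c * (4 - (q + 1 / q)^2) - a^2 * (2 - (q + 1 / q))"
  using q unfolding qseq_shift qseq_at[where i = i] by (simp add: field_simps eval_nat_numeral)

text \<open>This and \<open>qseq_\<xi>2\<close> match the coefficients of
  \<open>R L R\<^sup>2\<close> and \<open>R\<^sup>2 L R\<close> with those of the combination of
  \<open>R U\<^sub>i\<close> and \<open>U\<^sub>i\<^sub>+\<^sub>1 R\<close>.\<close>

lemma qseq_\<xi>1: "qseq q x 0 y (i - 1) + q * (q + 1) * qseq q x 0 y (i + 2)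
    = q * (q + 1 / q + 1) * qseq q x 0 y (i + 1)"
  using q unfolding qseq_shift qseq_at[where i = i] by (simp add: field_simps eval_nat_numeral)

lemma qseq_\<xi>2: "(q + 1) * qseq q x 0 y (i - 1) + q\<^sup>2 * qseq q x 0 y (i + 2)
    = q * (q + 1 / q + 1) * qseq q x 0 y i"
  using q unfolding qseq_shift qseq_at[where i = i] by (simp add: field_simps eval_nat_numeral)

text \<open>Matches the coefficients of \<open>R\<^sup>2\<close>; \<open>D\<close> will be
  \<open>q ^ (N + M - 1)\<close>. On the left \<open>x\<close> cancels and \<open>y * D\<close> is a
  multiple of \<open>c * c'\<close>; on the right only a multiple of \<open>c * c'\<close> remains
  once \<open>b * b' = 0\<close>.\<close>

lemma qseq_uniform:
  fixes a b c a' b' c' x y D :: complex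
  assumes bb': "b * b' = 0" and y: "y * D = - ((q - 1)^2 * c * c' / q^2)"
  defines "\<theta> \<equiv> qseq q a b c" and "\<theta>' \<equiv> qseq q a' b' c'" and "\<xi> \<equiv> qseq q x 0 y"
  defines "d \<equiv> \<lambda>i. (q + 1) * D / q powi i"
  shows "\<xi> (i + 2) * d (i + 1) - \<xi> (i - 1) * d i / q =
       (\<theta>' (i + 2) - \<theta>' i) * (\<theta> i + \<theta> (i + 1) + \<theta> (i + 2) - a * (2 - (q + 1 / q)))
       + (q + 1 / q + 1) * (\<theta> i * \<theta>' i + \<theta>' (i + 1) * (\<theta> (i + 2) - \<theta> i) - \<theta>' (i + 2) * \<theta> (i + 2))"
proof -
  define u where "u = q powi i"
  have u: "u \<noteq> 0" using q by (simp add: u_def)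
  have "\<xi> (i + 2) * d (i + 1) - \<xi> (i - 1) * d i / q =
    (y * D) * (q + 1) * (1 / (u^2 * q^3) - 1 / u^2)"
    using q u unfolding d_def \<xi>_def qseq_shift power_int_add[OF disjI1[OF q]] u_def[symmetric]
    by (simp add: field_simps eval_nat_numeral)
  also have "\<dots> = (q - 1)^2 * (q + 1) * (q^3 - 1) / (u^2 * q^5) * c * c'"
    unfolding y using q u by (simp add: field_simps eval_nat_numeral)
  also have "\<dots> = (\<theta>' (i + 2) - \<theta>' i) * (\<theta> i + \<theta> (i + 1) + \<theta> (i + 2) - a * (2 - (q + 1 / q)))
       + (q + 1 / q + 1) * (\<theta> i * \<theta>' i + \<theta>' (i + 1) * (\<theta> (i + 2) - \<theta> i) - \<theta>' (i + 2) * \<theta> (i + 2))"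
  proof (cases "b = 0")
    case True
    show ?thesis
      using q u unfolding True \<theta>_def \<theta>'_def qseq_shift qseq_at[where i = i] u_def[symmetric]
      by (simp add: field_simps eval_nat_numeral)
  next
    case False
    hence b': "b' = 0" using bb' by simp
    show ?thesis
      using q u unfolding b' \<theta>_def \<theta>'_def qseq_shift qseq_at[where i = i] u_def[symmetric]
      by (simp add: field_simps eval_nat_numeral)
  qed
  finally show ?thesis .
qed

end

section \<open>The tridiagonal relation on homogeneous vectors\<close>

definition tridiag :: "complex \<Rightarrow> complex \<Rightarrow> complex \<Rightarrow> complex ^ 'n ^ 'n \<Rightarrow> complex ^ 'n ^ 'n \<Rightarrow> complex ^ 'n ^ 'n" where
  "tridiag \<beta> \<gamma> \<rho> A A' = commutator A (A ** A ** A' - \<beta> *\<^sub>C (A ** A' ** A) + A' ** A ** A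
       - \<gamma> *\<^sub>C (A ** A' + A' ** A) - \<rho> *\<^sub>C A')"

lemma cscale_matrix_vector: "(c *\<^sub>C X) *v v = c *s (X *v v)"
  by (simp add: vec_eq_iff cscale_def matrix_vector_mult_def sum_distrib_left mult.assoc)

text \<open>The outer terms of the bracket add 1 to the \<beta> of its middle term, whence
  \<open>\<beta> + 1\<close>; the products \<open>A A' A\<close> from the \<gamma> part
  cancel.\<close>

lemma tridiag_vector:
  fixes A A' :: "complex ^ 'n ^ 'n"
  shows "tridiag \<beta> \<gamma> \<rho> A A' *v v =
    A *v (A *v (A *v (A' *v v))) - A' *v (A *v (A *v (A *v v)))
    - (\<beta> + 1) *s (A *v (A *v (A' *v (A *v v))) - A *v (A' *v (A *v (A *v v))))
    - \<gamma> *s (A *v (A *v (A' *v v)) - A' *v (A *v (A *v v)))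
    - \<rho> *s (A *v (A' *v v) - A' *v (A *v v))"
  unfolding tridiag_def commutator_def
  by (simp add: matrix_vector_mult_diff_rdistrib matrix_vector_mult_add_rdistrib
      matrix_vector_mul_assoc[symmetric] cscale_matrix_vector matrix_vector_right_distrib
      matrix_vector_mult_diff_distrib vector_scalar_commute vec_eq_iff algebra_simps)

text \<open>Only the grading, the relation \<open>uniform\<close> and scalar recurrences enter;
  membership in \<open>H i\<close> tells which scalars act.\<close>

lemma tridiag_graded_eq_0:
  fixes R L A A' :: "complex ^ 'n ^ 'n" and H :: "int \<Rightarrow> (complex ^ 'n) set"
    and \<alpha> \<alpha>' \<theta> \<theta>' \<xi> d :: "int \<Rightarrow> complex"
  assumes R: "\<And>i v. v \<in> H i \<Longrightarrow> R *v v \<in> H (i + 1)"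
    and L: "\<And>i v. v \<in> H i \<Longrightarrow> L *v v \<in> H (i - 1)"
    and A: "\<And>i v. v \<in> H i \<Longrightarrow> A *v v = \<alpha> i *s (R *v v) + \<theta> i *s v"
    and A': "\<And>i v. v \<in> H i \<Longrightarrow> A' *v v = \<alpha>' i *s (L *v v) + \<theta>' i *s v"
    and \<xi>: "\<And>i. \<alpha> i * \<alpha>' (i + 1) = \<xi> i"
    and uniform: "\<And>i v. v \<in> H i \<Longrightarrow> (q + 1) *s (R *v (L *v (R *v v))) =
      q *s (R *v (R *v (L *v v))) + L *v (R *v (R *v v)) + d i *s (R *v v)"
    and q: "q \<noteq> 0" and \<beta>: "\<beta> = q + 1 / q"
    and \<gamma>: "\<And>i. \<theta> (i - 1) - \<beta> * \<theta> i + \<theta> (i + 1) = \<gamma>"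
    and \<rho>: "\<And>i. (\<theta> i)^2 - \<beta> * \<theta> i * \<theta> (i + 1) + (\<theta> (i + 1))^2 - \<gamma> * (\<theta> i + \<theta> (i + 1)) = \<rho>"
    and \<theta>': "\<And>i. \<theta>' i - (\<beta> + 1) * \<theta>' (i + 1) + (\<beta> + 1) * \<theta>' (i + 2) - \<theta>' (i + 3) = 0"
    and \<xi>1: "\<And>i. \<xi> (i - 1) + q * (q + 1) * \<xi> (i + 2) = q * (\<beta> + 1) * \<xi> (i + 1)"
    and \<xi>2: "\<And>i. (q + 1) * \<xi> (i - 1) + q\<^sup>2 * \<xi> (i + 2) = q * (\<beta> + 1) * \<xi> i"
    and d: "\<And>i. \<xi> (i + 2) * d (i + 1) - \<xi> (i - 1) * d i / q =
       (\<theta>' (i + 2) - \<theta>' i) * (\<theta> i + \<theta> (i + 1) + \<theta> (i + 2) - \<gamma>)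
       + (\<beta> + 1) * (\<theta> i * \<theta>' i + \<theta>' (i + 1) * (\<theta> (i + 2) - \<theta> i) - \<theta>' (i + 2) * \<theta> (i + 2))"
    and v: "v \<in> H i"
  shows "tridiag \<beta> \<gamma> \<rho> A A' *v v = 0"
proof -
  define r l where "r = R *v v" and "l = L *v v"
  define rr lr rl where "rr = R *v r" and "lr = L *v r" and "rl = R *v l"
  define rrr lrr rlr rrl where "rrr = R *v rr" and "lrr = L *v rr" and "rlr = R *v lr" and "rrl = R *v rl"
  define lrrr rlrr rrlr rrrl where "lrrr = L *v rrr" and "rlrr = R *v lrr" and "rrlr = R *v rlr" and "rrrl = R *v rrl"
  note defs = r_def l_def rr_def lr_def rl_def rrr_def lrr_def rlr_def rrl_def lrrr_def rlrr_def rrlr_def rrrl_def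
  have H1: "r \<in> H (i + 1)" "l \<in> H (i - 1)" using v R L by (auto simp: r_def l_def)
  have H2: "rr \<in> H (i + 2)" "lr \<in> H i" "rl \<in> H i"
    using R[OF H1(1)] L[OF H1(1)] R[OF H1(2)] by (simp_all add: rr_def lr_def rl_def add.assoc)
  have H3: "rrr \<in> H (i + 3)" "lrr \<in> H (i + 1)" "rlr \<in> H (i + 1)" "rrl \<in> H (i + 1)"
    using R[OF H2(1)] L[OF H2(1)] R[OF H2(2)] R[OF H2(3)]
    by (simp_all add: rrr_def lrr_def rlr_def rrl_def add.commute[of i])
  note act = A[OF v, folded r_def] A'[OF v, folded l_def]
    A[OF H1(1), folded rr_def] A'[OF H1(1), folded lr_def] A[OF H1(2), folded rl_def]
    A[OF H2(1), folded rrr_def] A'[OF H2(1), folded lrr_def] A[OF H2(2), folded rlr_def] A[OF H2(3), folded rrl_def]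
    A'[OF H3(1), folded lrrr_def] A[OF H3(2), folded rlrr_def] A[OF H3(3), folded rrlr_def] A[OF H3(4), folded rrrl_def]
  \<comment> \<open>\<open>U1\<close> is \<open>R\<close> applied to the relation at
    \<open>v\<close>, and \<open>U2\<close> is the relation at \<open>R v\<close>.\<close>
  have U1: "(q + 1) *s rrlr = q *s rrrl + rlrr + d i *s rr"
    using arg_cong[OF uniform[OF v], of "\<lambda>t. R *v t"]
    by (simp add: defs matrix_vector_right_distrib vector_scalar_commute)
  have U2: "(q + 1) *s rlrr = q *s rrlr + lrrr + d (i + 1) *s rr"
    using uniform[OF H1(1)] by (simp add: defs)
  have \<gamma>': "\<gamma> = \<theta> (i - 1) - \<beta> * \<theta> i + \<theta> (i + 1)" and \<gamma>'': "\<gamma> = \<theta> i - \<beta> * \<theta> (i + 1) + \<theta> (i + 2)"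
    using \<gamma>[of i] \<gamma>[of "i + 1"] by (simp_all add: add.assoc)
  have \<rho>': "\<rho> = (\<theta> i)^2 - \<beta> * \<theta> i * \<theta> (i + 1) + (\<theta> (i + 1))^2 - \<gamma> * (\<theta> i + \<theta> (i + 1))"
    and \<rho>'': "\<rho> = (\<theta> (i - 1))^2 - \<beta> * \<theta> (i - 1) * \<theta> i + (\<theta> i)^2 - \<gamma> * (\<theta> (i - 1) + \<theta> i)"
    using \<rho>[of i] \<rho>[of "i - 1"] by simp_all
  have \<xi>': "\<alpha> (i - 1) * \<alpha>' i = \<xi> (i - 1)" "\<alpha> i * \<alpha>' (i + 1) = \<xi> i"
      "\<alpha> (i + 1) * \<alpha>' (i + 2) = \<xi> (i + 1)" "\<alpha> (i + 2) * \<alpha>' (i + 3) = \<xi> (i + 2)"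
    using \<xi>[of "i - 1"] \<xi>[of i] \<xi>[of "i + 1"] \<xi>[of "i + 2"] by (simp_all add: add.assoc)
  \<comment> \<open>the coefficient of \<open>R\<^sup>2\<close> in degree \<open>i + 2\<close>, divided by \<open>\<alpha>\<^sub>i \<alpha>\<^sub>i\<^sub>+\<^sub>1\<close>\<close>
  define T where "T = (\<theta>' i - \<theta>' (i + 2)) * (\<theta> i + \<theta> (i + 1) + \<theta> (i + 2) - \<gamma>)
    - (\<beta> + 1) * (\<theta> i * \<theta>' i + \<theta>' (i + 1) * (\<theta> (i + 2) - \<theta> i) - \<theta>' (i + 2) * \<theta> (i + 2))"
  show ?thesis
  proof (rule vec_eq_iff[THEN iffD2], rule allI)
    fix x
    define b1 where "b1 = \<beta> + 1"
    \<comment> \<open>Grouped by degree, from \<open>i + 3\<close> down to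
      \<open>i - 1\<close>.\<close>
    have eq: "(tridiag \<beta> \<gamma> \<rho> A A' *v v) $ x =
       \<alpha> i * \<alpha> (i + 1) * \<alpha> (i + 2) * (\<theta>' i - b1 * \<theta>' (i + 1) + b1 * \<theta>' (i + 2) - \<theta>' (i + 3)) * rrr $ x
     + \<alpha> i * \<alpha> (i + 1) * (\<alpha> (i - 1) * \<alpha>' i * rrrl $ x - b1 * (\<alpha> i * \<alpha>' (i + 1)) * rrlr $ x
         + b1 * (\<alpha> (i + 1) * \<alpha>' (i + 2)) * rlrr $ x - \<alpha> (i + 2) * \<alpha>' (i + 3) * lrrr $ x
         + ((\<theta>' i - \<theta>' (i + 2)) * (\<theta> i + \<theta> (i + 1) + \<theta> (i + 2) - \<gamma>)
    - b1 * (\<theta> i * \<theta>' i + \<theta>' (i + 1) * (\<theta> (i + 2) - \<theta> i) - \<theta>' (i + 2) * \<theta> (i + 2))) * rr $ x)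
     + \<alpha> i * (\<alpha> (i - 1) * \<alpha>' i * (\<theta> (i - 1) + \<theta> i + \<theta> (i + 1) - b1 * \<theta> i - \<gamma>) * rrl $ x
          - \<alpha> (i + 1) * \<alpha>' (i + 2) * (\<theta> i + \<theta> (i + 1) + \<theta> (i + 2) - b1 * \<theta> (i + 1) - \<gamma>) * lrr $ x
          + (\<theta>' i - \<theta>' (i + 1)) * ((\<theta> i)\<^sup>2 + \<theta> i * \<theta> (i + 1) + (\<theta> (i + 1))\<^sup>2 - b1 * \<theta> i * \<theta> (i + 1)
               - \<gamma> * (\<theta> i + \<theta> (i + 1)) - \<rho>) * r $ x)
     + \<alpha> (i - 1) * \<alpha>' i * ((\<theta> (i - 1))\<^sup>2 + \<theta> (i - 1) * \<theta> i + (\<theta> i)\<^sup>2 - b1 * \<theta> (i - 1) * \<theta> i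
               - \<gamma> * (\<theta> (i - 1) + \<theta> i) - \<rho>) * rl $ x
     - \<alpha> i * \<alpha>' (i + 1) * ((\<theta> i)\<^sup>2 + \<theta> i * \<theta> (i + 1) + (\<theta> (i + 1))\<^sup>2 - b1 * \<theta> i * \<theta> (i + 1)
               - \<gamma> * (\<theta> i + \<theta> (i + 1)) - \<rho>) * lr $ x
     + \<alpha>' i * (\<theta> (i - 1) - \<theta> i) * ((\<theta> (i - 1))\<^sup>2 + \<theta> (i - 1) * \<theta> i + (\<theta> i)\<^sup>2 - b1 * \<theta> (i - 1) * \<theta> i
               - \<gamma> * (\<theta> (i - 1) + \<theta> i) - \<rho>) * l $ x"
      unfolding tridiag_vector b1_def[symmetric]
      by (simp only: act matrix_vector_right_distrib vector_scalar_commute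
          vector_add_component vector_minus_component vector_smult_component)
        (simp add: algebra_simps power2_eq_square power3_eq_cube)
    \<comment> \<open>Only degree \<open>i + 2\<close> uses \<open>U1\<close> and \<open>U2\<close>;
      the factor \<open>q\<close> clears the denominators.\<close>
    have "q * (\<xi> (i - 1) * rrrl $ x - b1 * \<xi> i * rrlr $ x
         + b1 * \<xi> (i + 1) * rlrr $ x - \<xi> (i + 2) * lrrr $ x + T * rr $ x) = 0"
    proof -
      have u1: "rlrr $ x = (q + 1) * rrlr $ x - q * rrrl $ x - d i * rr $ x"
        using arg_cong[OF U1, of "\<lambda>t. t $ x"] by (simp add: algebra_simps)
      have u2: "lrrr $ x = (q + 1) * rlrr $ x - q * rrlr $ x - d (i + 1) * rr $ x"
        using arg_cong[OF U2, of "\<lambda>t. t $ x"] by (simp add: algebra_simps)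
      have t: "T = \<xi> (i - 1) * d i / q - \<xi> (i + 2) * d (i + 1)"
        using d[of i] by (simp add: T_def algebra_simps)
      have qT: "q * T = \<xi> (i - 1) * d i - q * \<xi> (i + 2) * d (i + 1)"
        using q by (simp add: t algebra_simps)
      have x1: "q * b1 * \<xi> (i + 1) = \<xi> (i - 1) + q * (q + 1) * \<xi> (i + 2)"
        and x2: "q * b1 * \<xi> i = (q + 1) * \<xi> (i - 1) + q\<^sup>2 * \<xi> (i + 2)"
        using \<xi>1[of i] \<xi>2[of i] by (simp_all add: b1_def)
      have "q * (\<xi> (i - 1) * rrrl $ x - b1 * \<xi> i * rrlr $ x
         + b1 * \<xi> (i + 1) * rlrr $ x - \<xi> (i + 2) * lrrr $ x + T * rr $ x)
        = q * \<xi> (i - 1) * rrrl $ x - (q * b1 * \<xi> i) * rrlr $ x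
         + (q * b1 * \<xi> (i + 1)) * rlrr $ x - q * \<xi> (i + 2) * lrrr $ x + (q * T) * rr $ x"
        by (simp add: algebra_simps)
      also have "\<dots> = 0"
        \<comment> \<open>\<open>u2\<close> brings in \<open>rlrr\<close>, so \<open>u1\<close>
          comes last; only \<open>rrrl\<close>, \<open>rrlr\<close> and \<open>rr\<close> are
          left.\<close>
        unfolding x1 x2 qT u2 unfolding u1 by (simp add: algebra_simps power2_eq_square)
      finally show ?thesis .
    qed
    hence z: "\<xi> (i - 1) * rrrl $ x - b1 * \<xi> i * rrlr $ x
         + b1 * \<xi> (i + 1) * rlrr $ x - \<xi> (i + 2) * lrrr $ x + T * rr $ x = 0"
      using q by simp
    \<comment> \<open>\<open>c1\<close> and \<open>c3\<close> remove \<open>rrl\<close> and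
      \<open>lrr\<close>; \<open>e1\<close> and \<open>e2\<close> remove \<open>r\<close>,
      \<open>rl\<close>, \<open>lr\<close> and \<open>l\<close>.\<close>
    have c1: "\<theta> (i - 1) + \<theta> i + \<theta> (i + 1) - b1 * \<theta> i - \<gamma> = 0"
      by (simp add: \<gamma>' b1_def algebra_simps)
    have c3: "\<theta> i + \<theta> (i + 1) + \<theta> (i + 2) - b1 * \<theta> (i + 1) - \<gamma> = 0"
      by (simp add: \<gamma>'' b1_def algebra_simps)
    have e1: "(\<theta> i)\<^sup>2 + \<theta> i * \<theta> (i + 1) + (\<theta> (i + 1))\<^sup>2 - b1 * \<theta> i * \<theta> (i + 1)
               - \<gamma> * (\<theta> i + \<theta> (i + 1)) - \<rho> = 0"
      by (simp add: \<rho>' b1_def algebra_simps)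
    have e2: "(\<theta> (i - 1))\<^sup>2 + \<theta> (i - 1) * \<theta> i + (\<theta> i)\<^sup>2 - b1 * \<theta> (i - 1) * \<theta> i
               - \<gamma> * (\<theta> (i - 1) + \<theta> i) - \<rho> = 0"
      by (simp add: \<rho>'' b1_def algebra_simps)
    show "(tridiag \<beta> \<gamma> \<rho> A A' *v v) $ x = 0 $ x"
      unfolding eq c1 c3 e1 e2 \<xi>' \<theta>'[of i, folded b1_def] 
      using z unfolding T_def b1_def[symmetric] by simp
  qed
qed

section \<open>The weighted raising and lowering matrices\<close>

lemma transpose_diff: "transpose (A - B) = transpose A - transpose (B :: complex ^ 'n ^ 'm)"
  by (simp add: transpose_def vec_eq_iff)

lemma transpose_add: "transpose (A + B) = transpose A + transpose (B :: complex ^ 'n ^ 'm)"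
  by (simp add: transpose_def vec_eq_iff)

lemma transpose_cscale: "transpose (c *\<^sub>C A) = c *\<^sub>C transpose A"
  by (simp add: transpose_def cscale_def vec_eq_iff)

text \<open>The inner expression reads the same backwards, so only the outer commutator changes
  sign.\<close>

lemma transpose_tridiag:
  "transpose (tridiag \<beta> \<gamma> \<rho> A A') = - tridiag \<beta> \<gamma> \<rho> (transpose A) (transpose A')"
  by (simp add: tridiag_def commutator_def transpose_diff transpose_add transpose_cscale
      matrix_transpose_mul matrix_mul_assoc algebra_simps)

section \<open>Homogeneous vectors and matrices acting on them\<close>

definition graded_vec :: "'i set \<Rightarrow> ('i \<Rightarrow> nat) \<Rightarrow> int \<Rightarrow> (complex ^ 'i) set" where
  "graded_vec P rk i = {v. \<forall>y. v $ y \<noteq> 0 \<longrightarrow> y \<in> P \<and> int (rk y) = i}"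

text \<open>Right multiplication by \<open>F i\<close> selects columns, so the scalars depend on the
  rank of the column index \<open>y\<close>.\<close>

definition weighted :: "'i set \<Rightarrow> ('i \<Rightarrow> nat) \<Rightarrow> complex ^ 'i ^ 'i \<Rightarrow> (int \<Rightarrow> complex) \<Rightarrow> (int \<Rightarrow> complex)
    \<Rightarrow> complex ^ 'i ^ 'i" where
  "weighted P rk X \<alpha> \<theta> =
    (\<chi> x y. \<alpha> (int (rk y)) * X $ x $ y + (if x = y \<and> y \<in> P then \<theta> (int (rk y)) else 0))"

lemma weighted_vector:
  assumes v: "v \<in> graded_vec P rk i"
  shows "weighted P rk X \<alpha> \<theta> *v v = \<alpha> i *s (X *v v) + \<theta> i *s v"
proof (rule vec_eq_iff[THEN iffD2], rule allI)
  fix x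
  have "(weighted P rk X \<alpha> \<theta> *v v) $ x
      = (\<Sum>y\<in>UNIV. (\<alpha> (int (rk y)) * X $ x $ y + (if x = y \<and> y \<in> P then \<theta> (int (rk y)) else 0)) * v $ y)"
    by (simp add: weighted_def matrix_vector_mult_def)
  also have "\<dots> = (\<Sum>y\<in>UNIV. \<alpha> i * (X $ x $ y * v $ y) + (if x = y then \<theta> i * v $ y else 0))"
  proof (intro sum.cong refl)
    fix y
    show "(\<alpha> (int (rk y)) * X $ x $ y + (if x = y \<and> y \<in> P then \<theta> (int (rk y)) else 0)) * v $ y
      = \<alpha> i * (X $ x $ y * v $ y) + (if x = y then \<theta> i * v $ y else 0)"
      using v by (cases "v $ y = 0") (auto simp: graded_vec_def algebra_simps)
  qed
  also have "\<dots> = (\<alpha> i *s (X *v v) + \<theta> i *s v) $ x"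
    by (simp add: sum.distrib matrix_vector_mult_def sum_distrib_left)
  finally show "(weighted P rk X \<alpha> \<theta> *v v) $ x = (\<alpha> i *s (X *v v) + \<theta> i *s v) $ x" .
qed

lemma graded_vec_mult:
  assumes X: "\<And>x y. X $ x $ y \<noteq> 0 \<Longrightarrow> x \<in> P \<and> int (rk x) = int (rk y) + k"
    and v: "v \<in> graded_vec P rk i"
  shows "X *v v \<in> graded_vec P rk (i + k)"
  unfolding graded_vec_def
proof (intro CollectI allI impI)
  fix x assume "(X *v v) $ x \<noteq> 0"
  then obtain y where "X $ x $ y * v $ y \<noteq> 0"
    unfolding matrix_vector_mult_def by (auto elim: sum.not_neutral_contains_not_neutral)
  thus "x \<in> P \<and> int (rk x) = i + k" using X[of x y] v by (auto simp: graded_vec_def)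
qed

lemma matrix_vector_axis_nth: "(Z *v axis y 1) $ x = Z $ x $ y"
  for Z :: "complex ^ 'i ^ 'm"
  by (simp add: matrix_vector_mult_def axis_def if_distrib[of "(*) _"] cong: if_cong)

text \<open>Unit vectors at indices in \<open>P\<close> are homogeneous; \<open>out\<close> handles
  the remaining indices.\<close>

lemma eq_0_if_graded_vec:
  fixes Z :: "complex ^ 'i ^ 'i"
  assumes out: "\<And>y. y \<notin> P \<Longrightarrow> Z *v axis y 1 = 0"
    and graded: "\<And>i v. v \<in> graded_vec P rk i \<Longrightarrow> Z *v v = 0"
  shows "Z = 0"
proof -
  have "Z *v axis y 1 = 0" for y
  proof (cases "y \<in> P")
    case True
    hence "axis y 1 \<in> graded_vec P rk (int (rk y))" by (auto simp: graded_vec_def axis_def)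
    thus ?thesis by (rule graded)
  qed (rule out)
  thus ?thesis by (simp add: vec_eq_iff matrix_vector_axis_nth)
qed

lemma indicator_matrix_mult3:
  "((\<chi> x y. if f x y then 1 else 0) ** (\<chi> x y. if g x y then 1 else 0) **
    (\<chi> x y. if k x y then 1 else 0) :: complex ^ 'i ^ 'i) $ x $ y
   = of_nat (card {(w, z). f x w \<and> g w z \<and> k z y})" (is "?lhs = _")
proof -
  have "?lhs = (\<Sum>z\<in>UNIV. \<Sum>w\<in>UNIV. if f x w \<and> g w z \<and> k z y then 1 else 0)"
    by (auto simp: matrix_matrix_mult_def sum_distrib_right intro!: sum.cong)
  also have "\<dots> = (\<Sum>w\<in>UNIV. \<Sum>z\<in>UNIV. if f x w \<and> g w z \<and> k z y then 1 else 0)"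
    by (rule sum.swap)
  also have "\<dots> = (\<Sum>p\<in>UNIV. if f x (fst p) \<and> g (fst p) (snd p) \<and> k (snd p) y then 1 else 0)"
    by (simp add: sum.cartesian_product split_def flip: UNIV_Times_UNIV)
  also have "\<dots> = of_nat (card {p. f x (fst p) \<and> g (fst p) (snd p) \<and> k (snd p) y})"
    by (simp add: sum.If_cases)
  finally show ?thesis by (simp add: split_def)
qed

context attenuated_space
begin

section \<open>The relation \<open>U\<^sub>i\<close> as a matrix identity\<close>

lemma raising_nth: "raising P $ x $ y = (if x \<in> P \<and> y \<in> P \<and> cov y x then 1 else 0)"
  by (auto simp: raising_def covers_iff)

lemma lowering_nth: "lowering P $ x $ y = (if x \<in> P \<and> y \<in> P \<and> cov x y then 1 else 0)"
  by (auto simp: lowering_def covers_iff)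

lemma transpose_raising: "transpose (raising P) = lowering P"
  by (simp add: transpose_def vec_eq_iff raising_nth lowering_nth)

text \<open>All relations \<open>U\<^sub>i\<close> at once: the weight \<open>d\<close> reads the
  level off the column index.\<close>

lemma uniform_matrix:
  fixes q :: complex
  assumes q: "q = of_nat Q"
  defines "d \<equiv> \<lambda>i. (q + 1) * q ^ (N + M - 1) / q powi i"
  shows "(q + 1) *\<^sub>C (raising P ** lowering P ** raising P)
      - q *\<^sub>C (raising P ** raising P ** lowering P) - lowering P ** raising P ** raising P
    = weighted P dim (raising P) d (\<lambda>_. 0)"
proof (intro vec_eq_iff[THEN iffD2] allI)
  fix x y
  let ?E = "\<lambda>X. (X :: 'v cmat) $ x $ y"
  let ?RLR = "raising P ** lowering P ** raising P" and ?RRL = "raising P ** raising P ** lowering P"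
    and ?LRR = "lowering P ** raising P ** raising P"
  have RLR: "?E ?RLR = of_nat (card {(z, w). covers P x z \<and> covers P w z \<and> covers P w y})"
    unfolding raising_def lowering_def by (rule indicator_matrix_mult3)
  have RRL: "?E ?RRL = of_nat (card {(w, z). covers P x w \<and> covers P w z \<and> covers P y z})"
    unfolding raising_def lowering_def by (rule indicator_matrix_mult3)
  have LRR: "?E ?LRR = of_nat (card {(w, z). covers P w x \<and> covers P w z \<and> covers P z y})"
    unfolding raising_def lowering_def by (rule indicator_matrix_mult3)
  have q0: "q \<noteq> 0" using Q_gt_1 by (simp add: q)
  have "(q + 1) * ?E ?RLR = q * ?E ?RRL + ?E ?LRR + d (int (dim y)) * raising P $ x $ y"
  proof (cases "x \<in> P \<and> y \<in> P \<and> dim x = Suc (dim y)")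
    case True
    hence P: "x \<in> P" "y \<in> P" and dxy: "dim x = Suc (dim y)" by auto
    \<comment> \<open>The matrix product meets \<open>z\<close> before the top \<open>w\<close>,
      whereas \<open>paths_RLR\<close> lists \<open>w\<close> first.\<close>
    have "{(z, w). covers P x z \<and> covers P w z \<and> covers P w y} = prod.swap ` paths_RLR x y"
      using P P_downward[OF P(1)] by (auto simp: covers_iff paths_RLR_def cov_def)
    hence RLR': "?E ?RLR = of_nat (card (paths_RLR x y))"
      by (simp add: RLR card_image)
    have "w \<in> P" "z \<in> P" if "cov z y" "cov w x" for w z
      using that P P_downward by (auto simp: cov_def)
    hence "{(w, z). covers P x w \<and> covers P w z \<and> covers P y z} = paths_RRL x y"
      using P by (auto simp: covers_iff paths_RRL_def)
    hence RRL': "?E ?RRL = of_nat (card (paths_RRL x y))" by (simp add: RRL)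
    have "z \<in> P" if "cov z w" "w \<in> P" for w z
      using that P_downward by (auto simp: cov_def)
    hence "{(w, z). covers P w x \<and> covers P w z \<and> covers P z y} = paths_LRR x y"
      using P by (auto simp: covers_iff paths_LRR_def)
    hence LRR': "?E ?LRR = of_nat (card (paths_LRR x y))" by (simp add: LRR)
    have "dim y \<le> N + M - 1" using dim_P[OF P(1)] dxy by simp
    hence dy: "d (int (dim y)) = (q + 1) * q ^ (N + M - 1 - dim y)"
      using q0 power_diff[of q "dim y" "N + M - 1"] by (simp add: d_def del: diff_diff_left)
    have "(of_nat ((Q + 1) * card (paths_RLR x y)) :: complex) =
        of_nat (Q * card (paths_RRL x y) + card (paths_LRR x y)
    + (if cov y x then (Q + 1) * Q ^ (N + M - 1 - dim y) else 0))"
      using path_counts[OF P dxy] by (simp only:)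
    thus ?thesis unfolding RLR' RRL' LRR' dy raising_nth q using P
      by (cases "cov y x") (simp_all add: algebra_simps)
  next
    case False
    \<comment> \<open>Every path stays in \<open>P\<close> and rises by one level in total, so
      otherwise there is none.\<close>
    have e: "{(z, w). covers P x z \<and> covers P w z \<and> covers P w y} = {}"
      "{(w, z). covers P x w \<and> covers P w z \<and> covers P y z} = {}"
      "{(w, z). covers P w x \<and> covers P w z \<and> covers P z y} = {}"
      using False by (auto simp: covers_iff cov_def)
    have "raising P $ x $ y = 0" using False by (auto simp: raising_nth cov_def)
    thus ?thesis unfolding RLR RRL LRR e by simp
  qed
  thus "((q + 1) *\<^sub>C ?RLR - q *\<^sub>C ?RRL - ?LRR) $ x $ y
    = weighted P dim (raising P) d (\<lambda>_. 0) $ x $ y"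
    by (simp add: cscale_def weighted_def algebra_simps)
qed

section \<open>Vanishing of both commutators for weighted matrices\<close>

lemma weighted_axis:
  assumes "y \<notin> P" "\<And>x. X $ x $ y = 0"
  shows "weighted P dim X \<alpha> \<theta> *v axis y 1 = 0"
  using assms unfolding vec_eq_iff matrix_vector_axis_nth by (simp add: weighted_def)

lemma tridiag_weighted_raising:
  fixes q a b c a' b' c' x y :: complex
  assumes q: "q = of_nat Q" and bb': "b * b' = 0"
    and y: "y * q ^ (N + M - 1) = - ((q - 1)^2 * c * c' / q^2)"
    and \<xi>: "\<And>i. \<alpha> i * \<alpha>' (i + 1) = qseq q x 0 y i"
  shows "tridiag (q + 1 / q) (a * (2 - (q + 1 / q))) (b * c * (4 - (q + 1 / q)^2) - a^2 * (2 - (q + 1 / q)))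
    (weighted P dim (raising P) \<alpha> (qseq q a b c)) (weighted P dim (lowering P) \<alpha>' (qseq q a' b' c')) = 0"
proof (rule eq_0_if_graded_vec[where P = P and rk = dim])
  fix z assume "z \<notin> P"
  hence "weighted P dim (raising P) \<alpha> (qseq q a b c) *v axis z 1 = 0"
    "weighted P dim (lowering P) \<alpha>' (qseq q a' b' c') *v axis z 1 = 0"
    by (auto intro!: weighted_axis simp: raising_nth lowering_nth)
  thus "tridiag (q + 1 / q) (a * (2 - (q + 1 / q))) (b * c * (4 - (q + 1 / q)^2) - a^2 * (2 - (q + 1 / q)))
    (weighted P dim (raising P) \<alpha> (qseq q a b c)) (weighted P dim (lowering P) \<alpha>' (qseq q a' b' c'))
    *v axis z 1 = 0"
    by (simp add: tridiag_vector)
next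
  fix i v assume v: "v \<in> graded_vec P dim i"
  have q0: "q \<noteq> 0" using Q_gt_1 by (simp add: q)
  show "tridiag (q + 1 / q) (a * (2 - (q + 1 / q))) (b * c * (4 - (q + 1 / q)^2) - a^2 * (2 - (q + 1 / q)))
    (weighted P dim (raising P) \<alpha> (qseq q a b c)) (weighted P dim (lowering P) \<alpha>' (qseq q a' b' c'))
    *v v = 0"
  proof (rule tridiag_graded_eq_0[where H = "graded_vec P dim" and R = "raising P" and L = "lowering P"])
    fix i v assume v: "v \<in> graded_vec P dim i"
    show "raising P *v v \<in> graded_vec P dim (i + 1)"
      by (rule graded_vec_mult[OF _ v]) (auto simp: raising_nth cov_def split: if_splits)
    show "lowering P *v v \<in> graded_vec P dim (i - 1)"
      using graded_vec_mult[of "lowering P" P dim "-1", OF _ v]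
      by (force simp: lowering_nth cov_def split: if_splits)
    show "(q + 1) *s (raising P *v (lowering P *v (raising P *v v)))
      = q *s (raising P *v (raising P *v (lowering P *v v))) + lowering P *v (raising P *v (raising P *v v))
        + ((q + 1) * q ^ (N + M - 1) / q powi i) *s (raising P *v v)"
      using arg_cong[OF uniform_matrix[OF q], of "\<lambda>X. X *v v"] weighted_vector[OF v]
      by (simp add: matrix_vector_mult_diff_rdistrib cscale_matrix_vector
          matrix_vector_mul_assoc[symmetric] vec_eq_iff algebra_simps)
  next
    fix i
    show "qseq q x 0 y (i + 2) * ((q + 1) * q ^ (N + M - 1) / q powi (i + 1))
      - qseq q x 0 y (i - 1) * ((q + 1) * q ^ (N + M - 1) / q powi i) / q =
       (qseq q a' b' c' (i + 2) - qseq q a' b' c' i) *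
         (qseq q a b c i + qseq q a b c (i + 1) + qseq q a b c (i + 2) - a * (2 - (q + 1 / q)))
       + (q + 1 / q + 1) * (qseq q a b c i * qseq q a' b' c' i
         + qseq q a' b' c' (i + 1) * (qseq q a b c (i + 2) - qseq q a b c i)
         - qseq q a' b' c' (i + 2) * qseq q a b c (i + 2))"
      using qseq_uniform[OF q0 bb' y] .
  qed (use q0 v \<xi> qseq_\<gamma>[OF q0] qseq_\<rho>[OF q0] qseq_\<beta>[OF q0] qseq_\<xi>1[OF q0] qseq_\<xi>2[OF q0] in
      \<open>auto intro!: weighted_vector\<close>)
qed

text \<open>A transposed \<open>R\<close> entry in column level \<open>i\<close> of \<open>L\<close>
  comes from column level \<open>i - 1\<close>, hence the shifted weight.\<close>

lemma transpose_weighted_raising: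
  "transpose (weighted P dim (raising P) \<alpha> \<theta>) = weighted P dim (lowering P) (\<lambda>i. \<alpha> (i - 1)) \<theta>"
  by (auto simp: transpose_def weighted_def vec_eq_iff raising_nth lowering_nth cov_def)

lemma transpose_weighted_lowering:
  "transpose (weighted P dim (lowering P) \<alpha> \<theta>) = weighted P dim (raising P) (\<lambda>i. \<alpha> (i + 1)) \<theta>"
  by (auto simp: transpose_def weighted_def vec_eq_iff raising_nth lowering_nth cov_def add.commute)

text \<open>Transposition exchanges the two parameter sets. The new weights
  \<open>\<alpha>' (i + 1)\<close> for raising and \<open>\<alpha> (i - 1)\<close> for lowering
  yield the same products \<open>\<alpha> i * \<alpha>' (i + 1)\<close>.\<close>

lemma tridiag_weighted_lowering:
  fixes q a b c a' b' c' x y :: complex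
  assumes q: "q = of_nat Q" and bb': "b * b' = 0"
    and y: "y * q ^ (N + M - 1) = - ((q - 1)^2 * c * c' / q^2)"
    and \<xi>: "\<And>i. \<alpha> i * \<alpha>' (i + 1) = qseq q x 0 y i"
  shows "tridiag (q + 1 / q) (a' * (2 - (q + 1 / q))) (b' * c' * (4 - (q + 1 / q)^2) - a'^2 * (2 - (q + 1 / q)))
    (weighted P dim (lowering P) \<alpha>' (qseq q a' b' c')) (weighted P dim (raising P) \<alpha> (qseq q a b c)) = 0"
    (is "?T = 0")
proof -
  have "transpose ?T = 0"
    unfolding transpose_tridiag transpose_weighted_raising transpose_weighted_lowering
    by (subst tridiag_weighted_raising[where x = x and y = y])
      (use q bb' y \<xi> in \<open>auto simp: mult_ac\<close>)
  hence "transpose (transpose ?T) = transpose (0 :: 'v cmat)" by simp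
  thus ?thesis by (simp add: transpose_def vec_eq_iff)
qed

section \<open>Sums over levels as weighted matrices\<close>

lemma sum_levels:
  assumes F: "\<And>i. i \<in> I \<Longrightarrow> F i = diag_indicator (att_level smul h i)"
    and I: "finite I"
  shows "(\<Sum>i\<in>I. f i *\<^sub>C (X ** F i)) $ x $ y = (if y \<in> P \<and> dim y \<in> I then f (dim y) * X $ x $ y else 0)"
    and "(\<Sum>i\<in>I. f i *\<^sub>C F i) $ x $ y = (if x = y \<and> y \<in> P \<and> dim y \<in> I then f (dim y) else 0)"
proof -
  have "(\<Sum>i\<in>I. f i *\<^sub>C (X ** F i)) $ x $ y
    = (\<Sum>i\<in>I. if i = dim y then (if y \<in> P then f i * X $ x $ y else 0) else 0)"
    unfolding sum_component
  proof (intro sum.cong refl)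
    fix i assume i: "i \<in> I"
    have "(X ** F i) $ x $ y = (\<Sum>z\<in>UNIV. if z = y then (if y \<in> att_level smul h i then X $ x $ y else 0) else 0)"
      unfolding matrix_matrix_mult_def F[OF i] diag_indicator_def vec_lambda_beta
      by (intro sum.cong) auto
    thus "(f i *\<^sub>C (X ** F i)) $ x $ y = (if i = dim y then (if y \<in> P then f i * X $ x $ y else 0) else 0)"
      by (auto simp: cscale_def att_level_def)
  qed
  thus "(\<Sum>i\<in>I. f i *\<^sub>C (X ** F i)) $ x $ y = (if y \<in> P \<and> dim y \<in> I then f (dim y) * X $ x $ y else 0)"
    using I by simp
  have "(\<Sum>i\<in>I. f i *\<^sub>C F i) $ x $ y
    = (\<Sum>i\<in>I. if i = dim y then (if x = y \<and> y \<in> P then f i else 0) else 0)"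
    unfolding sum_component
    by (intro sum.cong refl) (auto simp: F cscale_def diag_indicator_def att_level_def)
  thus "(\<Sum>i\<in>I. f i *\<^sub>C F i) $ x $ y = (if x = y \<and> y \<in> P \<and> dim y \<in> I then f (dim y) else 0)"
    using I by simp
qed

lemma sum_raising_eq_weighted:
  assumes F: "\<And>i. i \<le> N \<Longrightarrow> F i = diag_indicator (att_level smul h i)"
    and \<alpha>: "\<And>i. i \<le> N - 1 \<Longrightarrow> \<alpha>z (int i) = \<alpha> i" and \<theta>: "\<And>i. i \<le> N \<Longrightarrow> \<theta>z (int i) = \<theta> i"
  shows "(\<Sum>i=0..N-1. \<alpha> i *\<^sub>C (raising P ** F i)) + (\<Sum>i=0..N. \<theta> i *\<^sub>C F i)
    = weighted P dim (raising P) \<alpha>z \<theta>z"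
proof (intro vec_eq_iff[THEN iffD2] allI)
  fix x y
  \<comment> \<open>A nonzero \<open>R\<close> entry has its column at level at most
    \<open>N - 1\<close>, so a summand \<open>i = N\<close> would vanish.\<close>
  have dy: "dim y \<le> N - 1" if "x \<in> P" "cov y x"
    using dim_P[OF that(1)] that(2) by (auto simp: cov_def)
  have e1: "(\<Sum>i=0..N-1. \<alpha> i *\<^sub>C (raising P ** F i)) $ x $ y
      = (if y \<in> P \<and> dim y \<in> {0..N-1} then \<alpha> (dim y) * raising P $ x $ y else 0)"
    by (rule sum_levels) (use F in auto)
  have e2: "(\<Sum>i=0..N. \<theta> i *\<^sub>C F i) $ x $ y
      = (if x = y \<and> y \<in> P \<and> dim y \<in> {0..N} then \<theta> (dim y) else 0)"
    by (rule sum_levels) (use F in auto)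
  show "((\<Sum>i=0..N-1. \<alpha> i *\<^sub>C (raising P ** F i)) + (\<Sum>i=0..N. \<theta> i *\<^sub>C F i)) $ x $ y
    = weighted P dim (raising P) \<alpha>z \<theta>z $ x $ y"
    using dy dim_P[of y] \<alpha>[of "dim y"] \<theta>[of "dim y"]
    unfolding vector_add_component e1 e2
    by (cases "x = y") (auto simp: weighted_def raising_nth cov_def)
qed

lemma sum_lowering_eq_weighted:
  assumes F: "\<And>i. i \<le> N \<Longrightarrow> F i = diag_indicator (att_level smul h i)"
    and \<alpha>: "\<And>i. 1 \<le> i \<Longrightarrow> i \<le> N \<Longrightarrow> \<alpha>z (int i) = \<alpha> i" and \<theta>: "\<And>i. i \<le> N \<Longrightarrow> \<theta>z (int i) = \<theta> i"
  shows "(\<Sum>i=1..N. \<alpha> i *\<^sub>C (lowering P ** F i)) + (\<Sum>i=0..N. \<theta> i *\<^sub>C F i)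
    = weighted P dim (lowering P) \<alpha>z \<theta>z"
proof (intro vec_eq_iff[THEN iffD2] allI)
  fix x y
  have e1: "(\<Sum>i=1..N. \<alpha> i *\<^sub>C (lowering P ** F i)) $ x $ y
      = (if y \<in> P \<and> dim y \<in> {1..N} then \<alpha> (dim y) * lowering P $ x $ y else 0)"
    by (rule sum_levels) (use F in auto)
  have e2: "(\<Sum>i=0..N. \<theta> i *\<^sub>C F i) $ x $ y
      = (if x = y \<and> y \<in> P \<and> dim y \<in> {0..N} then \<theta> (dim y) else 0)"
    by (rule sum_levels) (use F in auto)
  show "((\<Sum>i=1..N. \<alpha> i *\<^sub>C (lowering P ** F i)) + (\<Sum>i=0..N. \<theta> i *\<^sub>C F i)) $ x $ y
    = weighted P dim (lowering P) \<alpha>z \<theta>z $ x $ y"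
    \<comment> \<open>The sum over \<open>L\<close> starts at 1: columns of \<open>L\<close> at
      level 0 are zero, as nothing lies below the zero space.\<close>
    using dim_P[of y] \<alpha>[of "dim y"] \<theta>[of "dim y"]
    unfolding vector_add_component e1 e2
    by (cases "x = y") (auto simp: weighted_def lowering_nth cov_def)
qed

end

theorem theorem11p26:
  fixes smul :: "'f::{field,finite} \<Rightarrow> 'v::{ab_group_add,finite} \<Rightarrow> 'v"
    and h :: "'v set" and N M :: nat and q :: complex
    and \<alpha> \<alpha>' \<theta> \<theta>' \<xi> :: "nat \<Rightarrow> complex"
    and \<beta> \<gamma> \<gamma>' \<rho> \<rho>' :: complex
    and P :: "'v set set" and L R A A' :: "'v cmat" and F :: "nat \<Rightarrow> 'v cmat"
  assumes N: "N \<ge> 6" and M: "M \<ge> 1"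
    and q: "q = of_nat CARD('f)"
    and H: "vector_space smul" "vector_space.dim smul (UNIV :: 'v set) = N + M"
    and h: "module.subspace smul h" "vector_space.dim smul h = M"
    and P: "P = att_poset smul h"
    and L: "L = lowering P" and R: "R = raising P"
    and F: "\<And>i. i \<le> N \<Longrightarrow> F i = diag_indicator (att_level smul h i)"
    and \<alpha>: "\<And>i. i \<le> N - 1 \<Longrightarrow> \<alpha> i \<noteq> 0"
    and \<alpha>': "\<And>i. 1 \<le> i \<Longrightarrow> i \<le> N \<Longrightarrow> \<alpha>' i \<noteq> 0"
    and \<theta>: "\<And>i j. i \<le> N \<Longrightarrow> j \<le> N \<Longrightarrow> i \<noteq> j \<Longrightarrow> \<theta> i \<noteq> \<theta> j"
    and \<theta>': "\<And>i j. i \<le> N \<Longrightarrow> j \<le> N \<Longrightarrow> i \<noteq> j \<Longrightarrow> \<theta>' i \<noteq> \<theta>' j"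
    and A: "A = (\<Sum>i=0..N-1. \<alpha> i *\<^sub>C (R ** F i)) + (\<Sum>i=0..N. \<theta> i *\<^sub>C F i)"
    and A': "A' = (\<Sum>i=1..N. \<alpha>' i *\<^sub>C (L ** F i)) + (\<Sum>i=0..N. \<theta>' i *\<^sub>C F i)"
    and \<xi>: "\<And>i. i \<le> N - 1 \<Longrightarrow> \<xi> i = \<alpha> i * \<alpha>' (i + 1)"
    and cases: "\<exists>a b c a' b' c' x :: complex.
      \<comment> \<open>I+\<close>
      (b \<noteq> 0 \<and> b' = 0 \<and> c \<noteq> 0 \<and> c' \<noteq> 0 \<and>
       (\<forall>i\<le>N-1. \<xi> i = x - q powi (-1 - int N - int M - int i) * (q - 1)^2 * c * c') \<and>
       (\<forall>i\<le>N. \<theta> i = a + b * q powi (int i) + c * q powi (- int i)) \<and>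
       (\<forall>i\<le>N. \<theta>' i = a' + c' * q powi (- int i))) \<or>
      \<comment> \<open>I-\<close>
      (b = 0 \<and> b' \<noteq> 0 \<and> c \<noteq> 0 \<and> c' \<noteq> 0 \<and>
       (\<forall>i\<le>N-1. \<xi> i = x - q powi (-1 - int N - int M - int i) * (q - 1)^2 * c * c') \<and>
       (\<forall>i\<le>N. \<theta> i = a + c * q powi (- int i)) \<and>
       (\<forall>i\<le>N. \<theta>' i = a' + b' * q powi (int i) + c' * q powi (- int i))) \<or>
      \<comment> \<open>I0\<close>
      (b = 0 \<and> b' = 0 \<and> c \<noteq> 0 \<and> c' \<noteq> 0 \<and>
       (\<forall>i\<le>N-1. \<xi> i = x - q powi (-1 - int N - int M - int i) * (q - 1)^2 * c * c') \<and>
       (\<forall>i\<le>N. \<theta> i = a + c * q powi (- int i)) \<and>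
       (\<forall>i\<le>N. \<theta>' i = a' + c' * q powi (- int i))) \<or>
      \<comment> \<open>II+\<close>
      (c \<noteq> 0 \<and> c' = 0 \<and> b \<noteq> 0 \<and> b' \<noteq> 0 \<and>
       (\<forall>i\<le>N-1. \<xi> i = x - q powi (-1 - int N - int M - int i) * (q - 1)^2 * b * b') \<and>
       (\<forall>i\<le>N. \<theta> i = a + b * q powi (- int i) + c * q powi (int i)) \<and>
       (\<forall>i\<le>N. \<theta>' i = a' + b' * q powi (- int i))) \<or>
      \<comment> \<open>II-\<close>
      (c = 0 \<and> c' \<noteq> 0 \<and> b \<noteq> 0 \<and> b' \<noteq> 0 \<and>
       (\<forall>i\<le>N-1. \<xi> i = x - q powi (-1 - int N - int M - int i) * (q - 1)^2 * b * b') \<and>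
       (\<forall>i\<le>N. \<theta> i = a + b * q powi (- int i)) \<and>
       (\<forall>i\<le>N. \<theta>' i = a' + b' * q powi (- int i) + c' * q powi (int i))) \<or>
      \<comment> \<open>II0\<close>
      (c = 0 \<and> c' = 0 \<and> b \<noteq> 0 \<and> b' \<noteq> 0 \<and>
       (\<forall>i\<le>N-1. \<xi> i = x - q powi (-1 - int N - int M - int i) * (q - 1)^2 * b * b') \<and>
       (\<forall>i\<le>N. \<theta> i = a + b * q powi (- int i)) \<and>
       (\<forall>i\<le>N. \<theta>' i = a' + b' * q powi (- int i))) \<or>
      \<comment> \<open>III+\<close>
      (x \<noteq> 0 \<and> b \<noteq> 0 \<and> b' = 0 \<and> c = 0 \<and> c' \<noteq> 0 \<and>
       (\<forall>i\<le>N-1. \<xi> i = x) \<and>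
       (\<forall>i\<le>N. \<theta> i = a + b * q powi (int i)) \<and>
       (\<forall>i\<le>N. \<theta>' i = a' + c' * q powi (- int i))) \<or>
      \<comment> \<open>III-\<close>
      (x \<noteq> 0 \<and> b = 0 \<and> b' \<noteq> 0 \<and> c \<noteq> 0 \<and> c' = 0 \<and>
       (\<forall>i\<le>N-1. \<xi> i = x) \<and>
       (\<forall>i\<le>N. \<theta> i = a + c * q powi (- int i)) \<and>
       (\<forall>i\<le>N. \<theta>' i = a' + b' * q powi (int i)))"
    and \<beta>: "\<And>i. 2 \<le> i \<Longrightarrow> i \<le> N - 1 \<Longrightarrow>
      \<beta> + 1 = (\<theta> (i - 2) - \<theta> (i + 1)) / (\<theta> (i - 1) - \<theta> i) \<and>
      \<beta> + 1 = (\<theta>' (i - 2) - \<theta>' (i + 1)) / (\<theta>' (i - 1) - \<theta>' i)"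
    and \<gamma>: "\<And>i. 1 \<le> i \<Longrightarrow> i \<le> N - 1 \<Longrightarrow> \<gamma> = \<theta> (i - 1) - \<beta> * \<theta> i + \<theta> (i + 1)"
    and \<gamma>': "\<And>i. 1 \<le> i \<Longrightarrow> i \<le> N - 1 \<Longrightarrow> \<gamma>' = \<theta>' (i - 1) - \<beta> * \<theta>' i + \<theta>' (i + 1)"
    and \<rho>: "\<And>i. 1 \<le> i \<Longrightarrow> i \<le> N \<Longrightarrow>
      \<rho> = (\<theta> (i - 1))^2 - \<beta> * \<theta> (i - 1) * \<theta> i + (\<theta> i)^2 - \<gamma> * (\<theta> (i - 1) + \<theta> i)"
    and \<rho>': "\<And>i. 1 \<le> i \<Longrightarrow> i \<le> N \<Longrightarrow>
      \<rho>' = (\<theta>' (i - 1))^2 - \<beta> * \<theta>' (i - 1) * \<theta>' i + (\<theta>' i)^2 - \<gamma>' * (\<theta>' (i - 1) + \<theta>' i)"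
  shows
    "commutator A (A ** A ** A' - \<beta> *\<^sub>C (A ** A' ** A) + A' ** A ** A
       - \<gamma> *\<^sub>C (A ** A' + A' ** A) - \<rho> *\<^sub>C A') = 0 \<and>
     commutator A' (A' ** A' ** A - \<beta> *\<^sub>C (A' ** A ** A') + A ** A' ** A'
       - \<gamma>' *\<^sub>C (A' ** A + A ** A') - \<rho>' *\<^sub>C A) = 0"
proof -
  interpret vector_space smul by (rule H(1))
  obtain Basis :: "'v set" where Basis: "independent Basis" "UNIV \<subseteq> span Basis"
    using basis_exists[of UNIV] by metis
  interpret attenuated_space smul Basis "CARD('f)" h N M
    by unfold_locales (use Basis h H in auto)
  have q0: "q \<noteq> 0" using Q_gt_1 by (simp add: q)
  obtain a b c a' b' c' x where bb': "b * b' = 0"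
    and \<xi>x: "\<And>i. i \<le> N - 1 \<Longrightarrow> \<xi> i = x - q powi (-1 - int N - int M - int i) * (q - 1)^2 * c * c'"
    and \<theta>q: "\<And>i. i \<le> N \<Longrightarrow> \<theta> i = qseq q a b c (int i)"
    and \<theta>'q: "\<And>i. i \<le> N \<Longrightarrow> \<theta>' i = qseq q a' b' c' (int i)"
  proof -
    define C where "C = (\<lambda>a b c a' b' c' x. b * b' = 0 \<and>
       (\<forall>i\<le>N-1. \<xi> i = x - q powi (-1 - int N - int M - int i) * (q - 1)^2 * c * c') \<and>
       (\<forall>i\<le>N. \<theta> i = a + b * q powi (int i) + c * q powi (- int i)) \<and>
       (\<forall>i\<le>N. \<theta>' i = a' + b' * q powi (int i) + c' * q powi (- int i)))"
    \<comment> \<open>Cases II give the second disjunct. In cases III, \<open>c * c' = 0\<close>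
      reduces the formula for \<xi> to \<open>x\<close>.\<close>
    have "\<exists>a b c a' b' c' x. C a b c a' b' c' x \<or> C a c b a' c' b' x"
      using cases by (elim ex_forward) (unfold C_def, elim disjE conjE; simp add: add_ac)
    then obtain a b c a' b' c' x where "C a b c a' b' c' x"
      by blast
    thus ?thesis using that unfolding C_def qseq_def by blast
  qed
  \<comment> \<open>The coefficient of \<open>q powi (- i)\<close> in \<xi>.\<close>
  define y where "y = - ((q - 1)^2 * c * c' * q powi (-1 - int N - int M))"
  have \<xi>y: "\<xi> i = qseq q x 0 y (int i)" if "i \<le> N - 1" for i
  proof -
    have "q powi (-1 - int N - int M - int i) = q powi (-1 - int N - int M) * q powi (- int i)"
      using power_int_add[of q "-1 - int N - int M" "- int i"] q0 by simp
    thus ?thesis using \<xi>x[OF that] by (simp add: qseq_def y_def algebra_simps)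
  qed
  \<comment> \<open>The exponents \<open>-1 - N - M\<close> and \<open>N + M - 1\<close> add up to
    \<open>-2\<close>.\<close>
  have yD: "y * q ^ (N + M - 1) = - ((q - 1)^2 * c * c' / q^2)"
  proof -
    have "q powi (-1 - int N - int M) * q ^ (N + M - 1) = q powi (-1 - int N - int M) * q powi (int (N + M - 1))"
      by simp
    also have "\<dots> = q powi (-2)"
      using q0 N by (subst power_int_add[symmetric]) (auto simp: of_nat_diff)
    also have "\<dots> = 1 / q^2" by (simp add: power_int_minus inverse_eq_divide)
    finally show ?thesis by (simp add: y_def algebra_simps)
  qed
  \<comment> \<open>One instance of each recurrence determines its scalar: \<open>i = 2\<close> for
    \<beta>, where \<open>\<theta> 1 \<noteq> \<theta> 2\<close> permits the division, and
    \<open>i = 1\<close> for the others.\<close>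
  have \<beta>q: "\<beta> = q + 1 / q"
  proof -
    have "\<theta> 1 \<noteq> \<theta> 2" using \<theta>[of 1 2] N by simp
    hence "(\<beta> + 1) * (\<theta> 1 - \<theta> 2) = \<theta> 0 - \<theta> 3"
      using \<beta>[of 2] N by (simp add: divide_simps)
    also have "\<dots> = (q + 1 / q + 1) * (\<theta> 1 - \<theta> 2)"
      using qseq_\<beta>[OF q0, of a b c 0] \<theta>q[of 0] \<theta>q[of 1] \<theta>q[of 2] \<theta>q[of 3] N
      by (simp add: algebra_simps)
    finally show ?thesis using \<open>\<theta> 1 \<noteq> \<theta> 2\<close> by simp
  qed
  have \<gamma>q: "\<gamma> = a * (2 - (q + 1 / q))"
    using \<gamma>[of 1] qseq_\<gamma>[OF q0, of a b c 1] \<theta>q[of 0] \<theta>q[of 1] \<theta>q[of 2] N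
    by (simp add: \<beta>q numeral_2_eq_2)
  have \<gamma>'q: "\<gamma>' = a' * (2 - (q + 1 / q))"
    using \<gamma>'[of 1] qseq_\<gamma>[OF q0, of a' b' c' 1] \<theta>'q[of 0] \<theta>'q[of 1] \<theta>'q[of 2] N
    by (simp add: \<beta>q numeral_2_eq_2)
  have \<rho>q: "\<rho> = b * c * (4 - (q + 1 / q)^2) - a^2 * (2 - (q + 1 / q))"
    using \<rho>[of 1] qseq_\<rho>[OF q0, of a b c 0] \<theta>q[of 0] \<theta>q[of 1] N by (simp add: \<beta>q \<gamma>q)
  have \<rho>'q: "\<rho>' = b' * c' * (4 - (q + 1 / q)^2) - a'^2 * (2 - (q + 1 / q))"
    using \<rho>'[of 1] qseq_\<rho>[OF q0, of a' b' c' 0] \<theta>'q[of 0] \<theta>'q[of 1] N by (simp add: \<beta>q \<gamma>'q)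
  \<comment> \<open>extensions to all integers that keep \<open>\<xi>\<^sub>i = \<alpha>\<^sub>i \<alpha>\<^sup>*\<^sub>i\<^sub>+\<^sub>1\<close> valid everywhere\<close>
  define \<alpha>z where "\<alpha>z = (\<lambda>i. if 0 \<le> i \<and> i \<le> int (N - 1) then \<alpha> (nat i) else qseq q x 0 y i)"
  define \<alpha>'z where "\<alpha>'z = (\<lambda>i. if 1 \<le> i \<and> i \<le> int N then \<alpha>' (nat i) else 1)"
  have \<alpha>z: "\<alpha>z i * \<alpha>'z (i + 1) = qseq q x 0 y i" for i
  proof (cases "0 \<le> i \<and> i \<le> int (N - 1)")
    case True
    hence "nat i \<le> N - 1" "nat (i + 1) = nat i + 1" "i + 1 \<le> int N" using N by auto
    thus ?thesis using True \<xi>[of "nat i"] \<xi>y[of "nat i"] by (simp add: \<alpha>z_def \<alpha>'z_def)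
  next
    case False
    hence "\<not> (1 \<le> i + 1 \<and> i + 1 \<le> int N)" using N by auto
    thus ?thesis using False by (simp only: \<alpha>z_def \<alpha>'z_def if_False mult_1_right)
  qed
  have A_eq: "A = weighted P dim (raising P) \<alpha>z (qseq q a b c)"
    unfolding A R P by (rule sum_raising_eq_weighted) (use F \<theta>q in \<open>auto simp: \<alpha>z_def\<close>)
  have A'_eq: "A' = weighted P dim (lowering P) \<alpha>'z (qseq q a' b' c')"
    unfolding A' L P by (rule sum_lowering_eq_weighted) (use F \<theta>'q in \<open>auto simp: \<alpha>'z_def\<close>)
  have "tridiag \<beta> \<gamma> \<rho> A A' = 0"
    unfolding A_eq A'_eq \<beta>q \<gamma>q \<rho>q P using q bb' yD \<alpha>z by (rule tridiag_weighted_raising)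
  moreover have "tridiag \<beta> \<gamma>' \<rho>' A' A = 0"
    unfolding A_eq A'_eq \<beta>q \<gamma>'q \<rho>'q P using q bb' yD \<alpha>z by (rule tridiag_weighted_lowering)
  ultimately show ?thesis unfolding tridiag_def by blast
qed

end
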